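(* Let $s$ be a function of locally bounded variation on $\mathbb{R}$ with $s(x)=0$ for $x<0$. Suppose that for each $y>0$ the integral $\mathcal{L}\{\mathrm{d}s;y\}:=\int_0^\infty e^{-yx}\,\mathrm{d}s(x)$ exists in the $(\mathrm{C})$ sense. Assume furthermore that there exist $A,B>0$ such that $s(x)+A\log x$ is non-decreasing on $[B,\infty)$. Let $a,b$ be constants. Then $$\mathcal{L}\{\mathrm{d}s;y\}=a+b\log\left(\frac{1}{y}\right)+o(1),\qquad y\to0^+,$$ if and only if $$s(x)=s(0)+a+b\gamma+b\log x+o(1),\qquad x\to\infty,$$ where $\gamma$ is Euler's constant.
   Context: Stieltjes integrals $\int_0^x\varphi(t)\,\mathrm{d}s(t)$ are taken over $[0,x]$ with $s(0)$ as the initial value, so that $\int_0^x\mathrm{d}s(t)=s(x)-s(0)$. For a function $G$ vanishing on $(-\infty,0)$ and an integer $k\geq1$, let $G^{(-k)}(x)=\frac{1}{(k-1)!}\int_0^x(x-t)^{k-1}G(t)\,dt$ ($G^{(0)}=G$); $G$ has limit $\ell$ in the sense $(\mathrm{C},k)$ if $G^{(-k)}(x)=\ell x^k/k!+o(x^k)$ as $x\to\infty$, and "$(\mathrm{C})$" means $(\mathrm{C},k)$ for some $k$ (which may depend on $y$). The integral $\int_0^\infty e^{-yx}\mathrm{d}s(x)$ exists in the $(\mathrm{C})$ sense, with value $\mathcal{L}\{\mathrm{d}s;y\}$, if the function $x\mapsto\int_0^x e^{-yt}\,\mathrm{d}s(t)$ ($x\geq0$, extended by $0$ for $x<0$) has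 a $(\mathrm{C})$ limit as $x\to\infty$. *)

theory Defs
  imports "HOL-Analysis.Analysis" "HOL-Library.Landau_Symbols"
begin

definition is_partition :: "real \<Rightarrow> real \<Rightarrow> nat \<Rightarrow> (nat \<Rightarrow> real) \<Rightarrow> bool" where
  "is_partition a b n p \<longleftrightarrow> p 0 = a \<and> p n = b \<and> (\<forall>i<n. p i < p (Suc i))"

definition bounded_variation_on :: "(real \<Rightarrow> real) \<Rightarrow> real \<Rightarrow> real \<Rightarrow> bool" where
  "bounded_variation_on s a b \<longleftrightarrow>
     (\<exists>M. \<forall>n p. is_partition a b n p \<longrightarrow> (\<Sum>i<n. \<bar>s (p (Suc i)) - s (p i)\<bar>) \<le> M)"

definition locally_bounded_variation :: "(real \<Rightarrow> real) \<Rightarrow> bool" where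
  "locally_bounded_variation s \<longleftrightarrow> (\<forall>a b. a \<le> b \<longrightarrow> bounded_variation_on s a b)"

text \<open>Riemann--Stieltjes integral of phi with respect to s over [a,b] (limit of
  Riemann--Stieltjes sums as the mesh tends to 0).  Over [0,x], the integral of 1 is
  s(x) - s(0), matching the convention that s(0) is the initial value.\<close>
definition has_RS_integral :: "(real \<Rightarrow> real) \<Rightarrow> (real \<Rightarrow> real) \<Rightarrow> real \<Rightarrow> real \<Rightarrow> real \<Rightarrow> bool" where
  "has_RS_integral \<phi> s a b I \<longleftrightarrow>
     (\<forall>\<epsilon>>0. \<exists>\<delta>>0. \<forall>n p \<xi>.
        is_partition a b n p \<and> (\<forall>i<n. p i \<le> \<xi> i \<and> \<xi> i \<le> p (Suc i)) \<and>
        (\<forall>i<n. p (Suc i) - p i < \<delta>) \<longrightarrow>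
        \<bar>(\<Sum>i<n. \<phi> (\<xi> i) * (s (p (Suc i)) - s (p i))) - I\<bar> < \<epsilon>)"

definition RS_integral :: "(real \<Rightarrow> real) \<Rightarrow> (real \<Rightarrow> real) \<Rightarrow> real \<Rightarrow> real \<Rightarrow> real" where
  "RS_integral \<phi> s a b = (THE I. has_RS_integral \<phi> s a b I)"

text \<open>k-fold integral G^(-k) of a function G vanishing on (-inf,0); G^(0) = G.\<close>
definition iter_integral :: "(real \<Rightarrow> real) \<Rightarrow> nat \<Rightarrow> real \<Rightarrow> real" where
  "iter_integral G k x =
     (if k = 0 then G x
      else integral {0..x} (\<lambda>t. (x - t) ^ (k - 1) * G t) / fact (k - 1))"

definition cesaro_lim :: "(real \<Rightarrow> real) \<Rightarrow> nat \<Rightarrow> real \<Rightarrow> bool" where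
  "cesaro_lim G k l \<longleftrightarrow>
     (\<lambda>x. iter_integral G k x - l * x ^ k / fact k) \<in> o[at_top](\<lambda>x. x ^ k)"

definition partial_laplace :: "(real \<Rightarrow> real) \<Rightarrow> real \<Rightarrow> real \<Rightarrow> real" where
  "partial_laplace s y x = (if x < 0 then 0 else RS_integral (\<lambda>t. exp (- y * t)) s 0 x)"

definition laplace_C :: "(real \<Rightarrow> real) \<Rightarrow> real \<Rightarrow> real \<Rightarrow> bool" where
  "laplace_C s y l \<longleftrightarrow> (\<exists>k. cesaro_lim (partial_laplace s y) k l)"

end

theory Submission
  imports Defs "HOL-Probability.Probability" "HOL-Real_Asymp.Real_Asymp"
begin

text \<open>If \<open>T\<close> is exponentially distributed of rate \<open>y\<close>, integration by parts gives
  \<open>\<integral>\<^sub>0\<^sup>x exp (- y * t) ds(t) = E (s (min T x)) - s 0\<close>, which is nondecreasing in \<open>x\<close> when \<open>s\<close>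
  is. Adding to \<open>s\<close> a function asymptotic to \<open>A * ln\<close> produces a nondecreasing \<open>g\<close>, and a
  nondecreasing function with a Cesaro limit is bounded; hence \<open>E (g T)\<close> is finite, the Laplace
  integral converges in the ordinary sense, and \<open>L (1 / x) + s 0\<close> is the Abel mean
  \<open>E (s (x * u))\<close> for a standard exponential \<open>u\<close>. Since \<open>E (ln u) = - euler_mascheroni\<close>, the
  theorem compares \<open>s x - b * ln x\<close> with its Abel mean. From \<open>s\<close> to the mean one uses dominated
  convergence. Conversely, for independent \<open>u\<close>, \<open>v\<close> and monotone \<open>g\<close> with Abel mean \<open>G\<close>,
  \<open>E \<bar>g (x * u) - g (x * v)\<bar> = 2 * (G x - G (x / 2))\<close> is bounded, so \<open>g (x * u) - b * ln x\<close> is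
  bounded in mean, and by Weierstrass approximation the kernel \<open>exp (- u)\<close> can be replaced by a
  narrow bump (Karamata's method).\<close>

section \<open>The exponential distribution\<close>

definition exp_measure :: "real measure" where
  "exp_measure = density lborel (exponential_density 1)"

lemma sets_exp_measure [simp, measurable_cong]: "sets exp_measure = sets borel"
  by (simp add: exp_measure_def)

lemma space_exp_measure [simp]: "space exp_measure = UNIV"
  by (simp add: exp_measure_def)

interpretation exp_measure: prob_space exp_measure
  unfolding exp_measure_def by (rule prob_space_exponential_density) simp

lemma measure_exp_measure_UNIV [simp]: "measure exp_measure UNIV = 1"
  using exp_measure.prob_space by simp

lemma AE_exp_measure_neq: "AE u in exp_measure. u \<noteq> a"
  unfolding exp_measure_def using AE_lborel_singleton[of a] by (subst AE_density) auto

lemma AE_exp_measure_pos: "AE u in exp_measure. 0 < u"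
proof -
  have "AE u in exp_measure. 0 \<le> u"
    unfolding exp_measure_def by (subst AE_density) (auto simp: exponential_density_def)
  then show ?thesis
    using AE_exp_measure_neq[of 0] by eventually_elim simp
qed

lemma
  assumes "0 \<le> a"
  shows measure_exp_measure_greaterThan: "measure exp_measure {a<..} = exp (- a)"
    and measure_exp_measure_atLeast: "measure exp_measure {a..} = exp (- a)"
proof -
  have "distributed exp_measure lborel (\<lambda>u. u) (exponential_density 1)"
    by (auto simp: distributed_def exp_measure_def distr_id2 exponential_density_nonneg)
  from exp_measure.exponential_distributedD_gt[OF this assms]
  show greaterThan: "measure exp_measure {a<..} = exp (- a)"
    by (simp add: greaterThan_def)
  have "AE u in exp_measure. u \<in> {a..} \<longleftrightarrow> u \<in> {a<..}"
    using AE_exp_measure_neq[of a] by eventually_elim auto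
  then show "measure exp_measure {a..} = exp (- a)"
    unfolding greaterThan[symmetric] by (intro measure_eq_AE) auto
qed

lemma has_bochner_integral_exp_measure_scale:
  fixes g :: "real \<Rightarrow> real"
  assumes [measurable]: "g \<in> borel_measurable borel" and c: "c > 0"
  shows "has_bochner_integral exp_measure (\<lambda>u. g (u / c)) I \<longleftrightarrow>
         has_bochner_integral lborel (\<lambda>t. indicator {0..} t *\<^sub>R (g t * exp (- c * t))) (I / c)"
proof -
  have "has_bochner_integral exp_measure (\<lambda>u. g (u / c)) I \<longleftrightarrow>
      has_bochner_integral lborel (\<lambda>u. exponential_density 1 u *\<^sub>R g (u / c)) I"
    unfolding exp_measure_def has_bochner_integral_iff
    by (simp add: integrable_density integral_density exponential_density_nonneg)
  also have "\<dots> \<longleftrightarrow> has_bochner_integral lborel (\<lambda>t. exponential_density 1 (c * t) *\<^sub>R g t) (I / c)"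
    using lborel_has_bochner_integral_real_affine_iff[of c _ I 0] c by (simp add: field_simps)
  also have "(\<lambda>t. exponential_density 1 (c * t) *\<^sub>R g t)
      = (\<lambda>t. indicator {0..} t *\<^sub>R (g t * exp (- c * t)))"
    using c by (auto simp: exponential_density_def fun_eq_iff mult_less_0_iff)
  finally show ?thesis .
qed

lemma has_bochner_integral_exp_measure_power:
  fixes g :: "real \<Rightarrow> real"
  assumes [measurable]: "g \<in> borel_measurable borel"
    and g: "has_bochner_integral exp_measure (\<lambda>u. g (u / real (Suc n))) I"
  shows "has_bochner_integral exp_measure (\<lambda>u. g u * exp (- u) ^ n) (I / real (Suc n))"
proof -
  have "g t * exp (- t) ^ n * exp (- 1 * t) = g t * exp (- real (Suc n) * t)" for t
    by (simp add: algebra_simps flip: exp_of_nat_mult exp_add)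
  then show ?thesis
    using has_bochner_integral_exp_measure_scale[of g "real (Suc n)" I] g
      has_bochner_integral_exp_measure_scale[of "\<lambda>u. g u * exp (- u) ^ n" 1 "I / real (Suc n)"]
    by (simp only: assms) auto
qed

lemma
  assumes "h > -1"
  shows integrable_exp_measure_powr: "integrable exp_measure (\<lambda>u. u powr h)"
    and integral_exp_measure_powr: "(\<integral>u. u powr h \<partial>exp_measure) = Gamma (1 + h)"
proof -
  have "((\<lambda>t. if t \<in> {0..} then t powr h * exp (- 1 * t) else 0) has_integral Gamma (1 + h)) UNIV"
    unfolding has_integral_restrict_UNIV
    using Gamma_integral_real[of "1 + h"] assms by (simp add: exp_minus divide_inverse)
  also have "(\<lambda>t. if t \<in> {0..} then t powr h * exp (- 1 * t) else 0)
      = (\<lambda>t. indicator {0..} t *\<^sub>R (t powr h * exp (- 1 * t)))"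
    by auto
  finally have "((\<lambda>t. indicator {0..} t *\<^sub>R (t powr h * exp (- 1 * t))) has_integral
      Gamma (1 + h)) UNIV" .
  then have "has_bochner_integral lborel (\<lambda>t. indicator {0..} t *\<^sub>R (t powr h * exp (- 1 * t)))
      (Gamma (1 + h))"
    using Gamma_real_pos[of "1 + h"] assms
    by (intro has_bochner_integral_nn_integral nn_integral_has_integral_lborel)
      (auto simp: less_imp_le)
  then have "has_bochner_integral exp_measure (\<lambda>u. u powr h) (Gamma (1 + h))"
    using has_bochner_integral_exp_measure_scale[of "\<lambda>u. u powr h" 1] by simp
  then show "integrable exp_measure (\<lambda>u. u powr h)"
    and "(\<integral>u. u powr h \<partial>exp_measure) = Gamma (1 + h)"
    by (simp_all add: has_bochner_integral_iff)
qed

lemma integrable_exp_measure_ln: "integrable exp_measure ln"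
proof (rule Bochner_Integration.integrable_bound)
  show "integrable exp_measure (\<lambda>u. u powr 1 + 2 * u powr (- 1 / 2))"
    by (intro Bochner_Integration.integrable_add integrable_mult_right
        integrable_exp_measure_powr) auto
  show "AE u in exp_measure. norm (ln u) \<le> norm (u powr 1 + 2 * u powr (- 1 / 2))"
    using AE_exp_measure_pos
  proof eventually_elim
    case (elim u)
    have "ln u \<le> u powr 1" "- ln u \<le> 2 * u powr (- 1 / 2)"
      using elim ln_le_minus_one[of u] ln_le_minus_one[of "u powr (- 1 / 2)"]
      by (auto simp: ln_powr)
    moreover have "0 \<le> u powr 1" "0 \<le> u powr (- 1 / 2)" by simp_all
    ultimately show ?case unfolding real_norm_def by linarith
  qed
qed simp

text \<open>Integrating \<open>h * ln u \<le> u powr h - 1\<close> shows that \<open>Gamma (1 + h) - h * E (ln u)\<close> is minimal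
  at \<open>h = 0\<close>.\<close>

lemma integral_exp_measure_ln: "(\<integral>u. ln u \<partial>exp_measure) = - euler_mascheroni"
proof -
  let ?E = "\<integral>u. ln u \<partial>exp_measure"
  have "1 \<le> Gamma (1 + h) - h * ?E" if "h > -1" for h
  proof -
    have "h * ?E = (\<integral>u. h * ln u \<partial>exp_measure)" by simp
    also have "\<dots> \<le> (\<integral>u. u powr h - 1 \<partial>exp_measure)"
    proof (rule integral_mono_AE)
      show "AE u in exp_measure. h * ln u \<le> u powr h - 1"
        using AE_exp_measure_pos
      proof eventually_elim
        case (elim u)
        then show ?case using ln_le_minus_one[of "u powr h"] by (simp add: ln_powr)
      qed
    qed (use that in \<open>auto intro: integrable_exp_measure_ln integrable_exp_measure_powr\<close>)
    also have "\<dots> = Gamma (1 + h) - 1"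
      using that by (simp add: integrable_exp_measure_powr integral_exp_measure_powr)
    finally show ?thesis by linarith
  qed
  moreover have "((\<lambda>h. Gamma (1 + h) - h * ?E) has_real_derivative - euler_mascheroni - ?E) (at 0)"
    by (auto intro!: derivative_eq_intros elim!: nonpos_Ints_cases)
  ultimately have "- euler_mascheroni - ?E = 0"
    by (intro DERIV_local_min[where d = 1]) auto
  then show ?thesis by simp
qed

section \<open>Abel means\<close>

definition abel_mean :: "(real \<Rightarrow> real) \<Rightarrow> real \<Rightarrow> real" where
  "abel_mean f x = (\<integral>u. f (x * u) \<partial>exp_measure)"

definition locally_bounded :: "(real \<Rightarrow> real) \<Rightarrow> bool" where
  "locally_bounded f \<longleftrightarrow> (\<forall>x. bounded (f ` {0..x}))"

lemma locally_boundedE: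
  assumes "locally_bounded f"
  obtains K where "K \<ge> 0" "\<And>t. 0 \<le> t \<Longrightarrow> t \<le> x \<Longrightarrow> \<bar>f t\<bar> \<le> K"
proof -
  obtain K where "K > 0" "\<forall>z \<in> f ` {0..x}. norm z \<le> K"
    using assms unfolding locally_bounded_def bounded_pos by blast
  then show ?thesis
    using that[of K] by simp
qed

lemma locally_bounded_mono:
  assumes "mono f"
  shows "locally_bounded f"
proof -
  have "f ` {0..x} \<subseteq> {f 0..f x}" for x
    using monoD[OF assms] by auto
  then show ?thesis
    unfolding locally_bounded_def by (meson bounded_closed_interval bounded_subset)
qed

lemma locally_bounded_const: "locally_bounded (\<lambda>_. c)"
  by (intro locally_bounded_mono monoI order_refl)

lemma locally_bounded_diff:
  "locally_bounded f \<Longrightarrow> locally_bounded g \<Longrightarrow> locally_bounded (\<lambda>t. f t - g t)"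
  unfolding locally_bounded_def by (blast intro: bounded_minus_comp)

lemma locally_bounded_ln_majorant:
  assumes "locally_bounded f" and "((\<lambda>t. f t - b * ln t) \<longlongrightarrow> c) at_top"
  obtains K where "\<And>x u. 1 \<le> x \<Longrightarrow> 0 < u \<Longrightarrow> \<bar>f (x * u) - b * ln x\<bar> \<le> K + \<bar>b\<bar> * \<bar>ln u\<bar>"
proof -
  obtain X where X: "\<And>t. t \<ge> X \<Longrightarrow> \<bar>(f t - b * ln t) - c\<bar> < 1"
    using tendstoD[OF assms(2) zero_less_one]
    by (auto simp: eventually_at_top_linorder dist_real_def)
  obtain K where K: "K \<ge> 0" "\<And>t. 0 \<le> t \<Longrightarrow> t \<le> X \<Longrightarrow> \<bar>f t\<bar> \<le> K"
    using locally_boundedE[OF assms(1)] by blast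
  have "\<bar>f (x * u) - b * ln x\<bar> \<le> (K + \<bar>c\<bar> + 1 + \<bar>b\<bar> * \<bar>ln X\<bar>) + \<bar>b\<bar> * \<bar>ln u\<bar>"
    if "1 \<le> x" "0 < u" for x u
  proof (cases "x * u \<ge> X")
    case True
    have "f (x * u) - b * ln x = (f (x * u) - b * ln (x * u)) + b * ln u"
      using that by (simp add: ln_mult algebra_simps)
    then show ?thesis
      using X[OF True] K(1) unfolding abs_mult[symmetric] by linarith
  next
    case False
    then have "0 < x * u" "x * u < X" using that by simp_all
    then have "ln (x * u) \<le> ln X" by (intro ln_mono) auto
    then have "\<bar>ln x\<bar> \<le> \<bar>ln X\<bar> + \<bar>ln u\<bar>"
      using that by (simp add: ln_mult)
    then have "\<bar>b * ln x\<bar> \<le> \<bar>b\<bar> * \<bar>ln X\<bar> + \<bar>b\<bar> * \<bar>ln u\<bar>"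
      unfolding abs_mult distrib_left[symmetric] by (intro mult_left_mono) auto
    then show ?thesis
      using K(2)[of "x * u"] \<open>0 < x * u\<close> \<open>x * u < X\<close> by linarith
  qed
  then show ?thesis by (rule that)
qed

lemma integrable_dilate_of_ln_asymptotics:
  assumes [measurable]: "f \<in> borel_measurable borel" and "locally_bounded f"
    and "((\<lambda>t. f t - b * ln t) \<longlongrightarrow> c) at_top" and x: "x > 0"
  shows "integrable exp_measure (\<lambda>u. f (x * u))"
proof -
  obtain K where K: "\<And>x u. 1 \<le> x \<Longrightarrow> 0 < u \<Longrightarrow> \<bar>f (x * u) - b * ln x\<bar> \<le> K + \<bar>b\<bar> * \<bar>ln u\<bar>"
    using locally_bounded_ln_majorant assms by blast
  show ?thesis
  proof (rule Bochner_Integration.integrable_bound)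
    show "integrable exp_measure (\<lambda>u. K + \<bar>b\<bar> * (\<bar>ln x\<bar> + \<bar>ln u\<bar>))"
      using integrable_exp_measure_ln by auto
    show "AE u in exp_measure. norm (f (x * u)) \<le> norm (K + \<bar>b\<bar> * (\<bar>ln x\<bar> + \<bar>ln u\<bar>))"
      using AE_exp_measure_pos
    proof eventually_elim
      case (elim u)
      have "\<bar>b\<bar> * \<bar>ln (x * u)\<bar> \<le> \<bar>b\<bar> * (\<bar>ln x\<bar> + \<bar>ln u\<bar>)"
        using x elim by (intro mult_left_mono) (auto simp: ln_mult)
      then show ?case
        using K[of 1 "x * u"] x elim unfolding real_norm_def by simp linarith
    qed
  qed measurable
qed

lemma tendsto_dilate_ln_asymptotics:
  fixes f :: "real \<Rightarrow> real"
  assumes lim: "((\<lambda>t. f t - b * ln t) \<longlongrightarrow> c) at_top" and u: "u > 0"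
  shows "((\<lambda>x. f (x * u) - b * ln x) \<longlongrightarrow> c + b * ln u) at_top"
proof -
  have "filterlim (\<lambda>x. x * u) at_top at_top"
    using u by real_asymp
  from filterlim_compose[OF lim this]
  have "((\<lambda>x. f (x * u) - b * ln (x * u) + b * ln u) \<longlongrightarrow> c + b * ln u) at_top"
    by (intro tendsto_intros)
  then show ?thesis
  proof (rule Lim_transform_eventually)
    show "\<forall>\<^sub>F x in at_top. f (x * u) - b * ln (x * u) + b * ln u = f (x * u) - b * ln x"
      using eventually_gt_at_top[of 0]
      by eventually_elim (use u in \<open>simp add: ln_mult algebra_simps\<close>)
  qed
qed

proposition abel_mean_ln_asymptotics:
  assumes [measurable]: "f \<in> borel_measurable borel" and "locally_bounded f"
    and lim: "((\<lambda>t. f t - b * ln t) \<longlongrightarrow> c) at_top"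
  shows "((\<lambda>x. abel_mean f x - b * ln x) \<longlongrightarrow> c - b * euler_mascheroni) at_top"
proof -
  obtain K where K: "\<And>x u. 1 \<le> x \<Longrightarrow> 0 < u \<Longrightarrow> \<bar>f (x * u) - b * ln x\<bar> \<le> K + \<bar>b\<bar> * \<bar>ln u\<bar>"
    using locally_bounded_ln_majorant assms by blast
  have "((\<lambda>x. \<integral>u. f (x * u) - b * ln x \<partial>exp_measure) \<longlongrightarrow> (\<integral>u. c + b * ln u \<partial>exp_measure)) at_top"
  proof (rule integral_dominated_convergence_at_top)
    show "integrable exp_measure (\<lambda>u. K + \<bar>b\<bar> * \<bar>ln u\<bar>)"
      using integrable_exp_measure_ln by auto
    show "\<forall>\<^sub>F x in at_top. AE u in exp_measure. norm (f (x * u) - b * ln x) \<le> K + \<bar>b\<bar> * \<bar>ln u\<bar>"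
      using eventually_ge_at_top[of 1]
    proof eventually_elim
      case (elim x)
      show ?case
        using AE_exp_measure_pos by eventually_elim (use K elim in simp)
    qed
    show "AE u in exp_measure. ((\<lambda>x. f (x * u) - b * ln x) \<longlongrightarrow> c + b * ln u) at_top"
      using AE_exp_measure_pos by eventually_elim (rule tendsto_dilate_ln_asymptotics[OF lim])
  qed measurable
  also have "(\<integral>u. c + b * ln u \<partial>exp_measure) = c - b * euler_mascheroni"
    using integrable_exp_measure_ln by (simp add: integral_exp_measure_ln)
  finally show ?thesis
  proof (rule Lim_transform_eventually)
    show "\<forall>\<^sub>F x in at_top. (\<integral>u. f (x * u) - b * ln x \<partial>exp_measure) = abel_mean f x - b * ln x"
      using eventually_gt_at_top[of 0]
      by eventually_elim
         (use integrable_dilate_of_ln_asymptotics[OF assms] in \<open>simp add: abel_mean_def\<close>)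
  qed
qed

lemma
  assumes "x > 0"
  shows integrable_dilate_ln: "integrable exp_measure (\<lambda>u. ln (x * u))"
    and abel_mean_ln: "abel_mean ln x = ln x - euler_mascheroni"
proof -
  have ln_split: "AE u in exp_measure. ln (x * u) = ln x + ln u"
    using AE_exp_measure_pos by eventually_elim (use assms in \<open>auto simp: ln_mult\<close>)
  have "integrable exp_measure (\<lambda>u. ln x + ln u)"
    using integrable_exp_measure_ln by simp
  then show "integrable exp_measure (\<lambda>u. ln (x * u))"
    by (subst integrable_cong_AE[OF _ _ ln_split]) auto
  have "abel_mean ln x = (\<integral>u. ln x + ln u \<partial>exp_measure)"
    unfolding abel_mean_def by (rule integral_cong_AE[OF _ _ ln_split]) auto
  then show "abel_mean ln x = ln x - euler_mascheroni"
    using integrable_exp_measure_ln by (simp add: integral_exp_measure_ln)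
qed

definition order_sign :: "real \<Rightarrow> real \<Rightarrow> real" where
  "order_sign u v = 1 - 2 * indicator {u<..} v"

lemma measurable_order_sign [measurable]:
  "case_prod order_sign \<in> borel_measurable (borel \<Otimes>\<^sub>M borel)"
  unfolding order_sign_def indicator_def greaterThan_iff by measurable

lemma abs_order_sign [simp]: "\<bar>order_sign u v\<bar> = 1"
  by (simp add: order_sign_def indicator_def)

lemma integrable_order_sign [simp]: "integrable exp_measure (order_sign u)"
  by (rule exp_measure.integrable_const_bound[where B = 1]) auto

lemma
  assumes "u > 0"
  shows integral_order_sign: "(\<integral>v. order_sign u v \<partial>exp_measure) = 1 - 2 * exp (- u)"
    and integral_order_sign_flip: "(\<integral>v. order_sign v u \<partial>exp_measure) = - (1 - 2 * exp (- u))"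
proof -
  show "(\<integral>v. order_sign u v \<partial>exp_measure) = 1 - 2 * exp (- u)"
    using assms unfolding order_sign_def
    by (simp add: measure_exp_measure_greaterThan exp_measure.emeasure_eq_measure)
  have "order_sign v u = 2 * indicator {u..} v - 1" for v
    by (simp add: order_sign_def indicator_def)
  then show "(\<integral>v. order_sign v u \<partial>exp_measure) = - (1 - 2 * exp (- u))"
    using assms by (simp add: measure_exp_measure_atLeast exp_measure.emeasure_eq_measure)
qed

lemma
  assumes X: "integrable exp_measure X"
  shows integrable_mult_order_sign: "integrable exp_measure (\<lambda>v. X v * order_sign u v)"
    and integrable_integral_order_sign:
      "integrable exp_measure (\<lambda>u. \<integral>v. X v * order_sign u v \<partial>exp_measure)"
    and integral_integral_order_sign:
      "(\<integral>u. \<integral>v. X v * order_sign u v \<partial>exp_measure \<partial>exp_measure)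
        = - (\<integral>v. X v * (1 - 2 * exp (- v)) \<partial>exp_measure)"
proof -
  interpret pair: pair_prob_space exp_measure exp_measure ..
  have [measurable]: "X \<in> borel_measurable borel"
    using borel_measurable_integrable[OF X] by measurable
  show "integrable exp_measure (\<lambda>v. X v * order_sign u v)"
    using X by (rule Bochner_Integration.integrable_bound) (auto simp: abs_mult)
  have pair: "integrable (exp_measure \<Otimes>\<^sub>M exp_measure) (\<lambda>(v, u). X v * order_sign u v)"
    by (rule pair.Fubini_integrable)
       (use X in \<open>auto simp: abs_mult intro!: exp_measure.integrable_const_bound\<close>)
  then show "integrable exp_measure (\<lambda>u. \<integral>v. X v * order_sign u v \<partial>exp_measure)"
    by (rule pair.integrable_snd)
  have "(\<integral>u. \<integral>v. X v * order_sign u v \<partial>exp_measure \<partial>exp_measure)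
      = (\<integral>v. X v * (\<integral>u. order_sign u v \<partial>exp_measure) \<partial>exp_measure)"
    unfolding pair.Fubini_integral[OF pair] by simp
  also have "\<dots> = (\<integral>v. - (X v * (1 - 2 * exp (- v))) \<partial>exp_measure)"
    by (rule integral_cong_AE)
       (use AE_exp_measure_pos in
         \<open>auto simp: integral_order_sign_flip algebra_simps elim!: eventually_mono\<close>)
  finally show "(\<integral>u. \<integral>v. X v * order_sign u v \<partial>exp_measure \<partial>exp_measure)
      = - (\<integral>v. X v * (1 - 2 * exp (- v)) \<partial>exp_measure)"
    by simp
qed

lemma
  fixes X :: "real \<Rightarrow> real"
  assumes "mono X" and X: "integrable exp_measure X"
  shows integrable_mean_abs_difference_mono:
      "integrable exp_measure (\<lambda>u. \<integral>v. \<bar>X u - X v\<bar> \<partial>exp_measure)"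
    and mean_abs_difference_mono: "(\<integral>u. \<integral>v. \<bar>X u - X v\<bar> \<partial>exp_measure \<partial>exp_measure)
        = 2 * (\<integral>u. X u * (1 - 2 * exp (- u)) \<partial>exp_measure)"
proof -
  have [measurable]: "X \<in> borel_measurable borel"
    using \<open>mono X\<close> by (rule borel_measurable_mono)
  define R where "R u = (\<integral>v. X v * order_sign u v \<partial>exp_measure)" for u
  have inner: "AE u in exp_measure. (\<integral>v. \<bar>X u - X v\<bar> \<partial>exp_measure)
      = X u * (1 - 2 * exp (- u)) - R u"
    using AE_exp_measure_pos
  proof eventually_elim
    case (elim u)
    have "\<bar>X u - X v\<bar> = X u * order_sign u v - X v * order_sign u v" for v
      using monoD[OF \<open>mono X\<close>, of u v] monoD[OF \<open>mono X\<close>, of v u]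
      by (cases "u < v") (auto simp: order_sign_def)
    then show ?case
      using elim integrable_mult_order_sign[OF X] by (simp add: R_def integral_order_sign)
  qed
  have kernel: "integrable exp_measure (\<lambda>u. X u * (1 - 2 * exp (- u)))"
    by (rule Bochner_Integration.integrable_bound[OF X])
       (use AE_exp_measure_pos in
         \<open>auto simp: abs_mult abs_le_iff intro!: mult_left_le elim!: eventually_mono\<close>)
  have R: "integrable exp_measure R"
    unfolding R_def by (rule integrable_integral_order_sign[OF X])
  show "integrable exp_measure (\<lambda>u. \<integral>v. \<bar>X u - X v\<bar> \<partial>exp_measure)"
    by (subst integrable_cong_AE[OF _ _ inner]) (use kernel R in auto)
  have "(\<integral>u. \<integral>v. \<bar>X u - X v\<bar> \<partial>exp_measure \<partial>exp_measure)
      = (\<integral>u. X u * (1 - 2 * exp (- u)) - R u \<partial>exp_measure)"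
    by (rule integral_cong_AE[OF _ _ inner]) (use R in auto)
  then show "(\<integral>u. \<integral>v. \<bar>X u - X v\<bar> \<partial>exp_measure \<partial>exp_measure)
      = 2 * (\<integral>u. X u * (1 - 2 * exp (- u)) \<partial>exp_measure)"
    using kernel R integral_integral_order_sign[OF X] by (simp flip: R_def)
qed

text \<open>By Jensen's inequality the mean absolute deviation is at most Gini's mean difference, which
  for a monotone function is a linear functional.\<close>

lemma mean_abs_deviation_mono_le:
  fixes X :: "real \<Rightarrow> real"
  assumes "mono X" and X: "integrable exp_measure X"
  shows "(\<integral>u. \<bar>X u - (\<integral>v. X v \<partial>exp_measure)\<bar> \<partial>exp_measure)
    \<le> 2 * (\<integral>u. X u * (1 - 2 * exp (- u)) \<partial>exp_measure)"
proof -
  have "\<bar>X u - (\<integral>v. X v \<partial>exp_measure)\<bar> \<le> (\<integral>v. \<bar>X u - X v\<bar> \<partial>exp_measure)" for u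
    using integral_abs_bound[of exp_measure "\<lambda>v. X u - X v"] X by simp
  then have "(\<integral>u. \<bar>X u - (\<integral>v. X v \<partial>exp_measure)\<bar> \<partial>exp_measure)
      \<le> (\<integral>u. \<integral>v. \<bar>X u - X v\<bar> \<partial>exp_measure \<partial>exp_measure)"
    using X by (intro integral_mono integrable_mean_abs_difference_mono[OF assms]) auto
  then show ?thesis
    by (simp only: mean_abs_difference_mono[OF assms])
qed

section \<open>Karamata's Tauberian theorem\<close>

definition slowly_decreasing :: "(real \<Rightarrow> real) \<Rightarrow> bool" where
  "slowly_decreasing f \<longleftrightarrow>
     (\<forall>e>0. \<exists>\<beta>>1. \<forall>\<^sub>F x in at_top. \<forall>t\<in>{x..\<beta> * x}. f x - e \<le> f t)"

lemma has_bochner_integral_abel_mean_power: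
  fixes f :: "real \<Rightarrow> real"
  assumes [measurable]: "f \<in> borel_measurable borel"
    and int: "integrable exp_measure (\<lambda>u. f (x / real (Suc n) * u))"
  shows "has_bochner_integral exp_measure (\<lambda>u. f (x * u) * exp (- u) ^ n)
    (abel_mean f (x / real (Suc n)) / real (Suc n))"
proof (rule has_bochner_integral_exp_measure_power)
  show "has_bochner_integral exp_measure (\<lambda>u. f (x * (u / real (Suc n))))
      (abel_mean f (x / real (Suc n)))"
    using has_bochner_integral_integrable[OF int] by (simp add: abel_mean_def mult_ac)
qed measurable

lemma polynomial_kernel_tendsto_0:
  assumes f: "f \<in> borel_measurable borel" "\<And>x. x > 0 \<Longrightarrow> integrable exp_measure (\<lambda>u. f (x * u))"
    and lim: "(abel_mean f \<longlongrightarrow> 0) at_top"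
    and p: "real_polynomial_function p"
  shows "((\<lambda>x. \<integral>u. f (x * u) * p (exp (- u)) \<partial>exp_measure) \<longlongrightarrow> 0) at_top"
proof -
  obtain a n where p_sum: "p = (\<lambda>v. \<Sum>i\<le>n. a i * v ^ i)"
    using p real_polynomial_function_iff_sum by blast
  have "((\<lambda>x. \<Sum>i\<le>n. a i * (abel_mean f (x / real (Suc i)) / real (Suc i))) \<longlongrightarrow> 0) at_top"
  proof (rule tendsto_null_sum)
    fix i
    have "filterlim (\<lambda>x. x / real (Suc i)) at_top at_top"
      by real_asymp
    then have "((\<lambda>x. abel_mean f (x / real (Suc i))) \<longlongrightarrow> 0) at_top"
      by (rule filterlim_compose[OF lim])
    then show "((\<lambda>x. a i * (abel_mean f (x / real (Suc i)) / real (Suc i))) \<longlongrightarrow> 0) at_top"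
      by (intro tendsto_mult_right_zero tendsto_divide_zero)
  qed
  then show ?thesis
  proof (rule Lim_transform_eventually)
    show "\<forall>\<^sub>F x in at_top. (\<Sum>i\<le>n. a i * (abel_mean f (x / real (Suc i)) / real (Suc i)))
        = (\<integral>u. f (x * u) * p (exp (- u)) \<partial>exp_measure)"
      using eventually_gt_at_top[of 0]
    proof eventually_elim
      case (elim x)
      have "f (x * u) * p (exp (- u)) = (\<Sum>i\<le>n. a i * (f (x * u) * exp (- u) ^ i))" for u
        by (simp add: p_sum sum_distrib_left mult_ac)
      moreover have "has_bochner_integral exp_measure (\<lambda>u. \<Sum>i\<le>n. a i * (f (x * u) * exp (- u) ^ i))
          (\<Sum>i\<le>n. a i * (abel_mean f (x / real (Suc i)) / real (Suc i)))"
        by (intro has_bochner_integral_sum has_bochner_integral_mult_right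
            has_bochner_integral_abel_mean_power f divide_pos_pos elim of_nat_0_less_iff[THEN iffD2])
          simp
      ultimately show ?case
        by (simp only: has_bochner_integral_iff)
    qed
  qed
qed

lemma integrable_mult_continuous_kernel:
  fixes F g :: "real \<Rightarrow> real"
  assumes F: "integrable exp_measure F" and g: "continuous_on UNIV g"
  shows "integrable exp_measure (\<lambda>u. F u * g (exp (- u)))"
proof -
  have [measurable]: "g \<in> borel_measurable borel"
    using g by (rule borel_measurable_continuous_onI)
  obtain M where M: "\<And>v. v \<in> {0..1} \<Longrightarrow> \<bar>g v\<bar> \<le> M"
    using compact_continuous_image[OF continuous_on_subset[OF g] compact_Icc, of 0 1]
    by (force dest!: compact_imp_bounded simp: bounded_iff)
  have bound: "AE u in exp_measure. norm (F u * g (exp (- u))) \<le> norm (F u * M)"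
    using AE_exp_measure_pos
  proof eventually_elim
    case (elim u)
    then have "\<bar>g (exp (- u))\<bar> \<le> \<bar>M\<bar>"
      using M[of "exp (- u)"] by simp
    then show ?case by (simp add: abs_mult mult_left_mono)
  qed
  show ?thesis
  proof (rule Bochner_Integration.integrable_bound)
    show "integrable exp_measure (\<lambda>u. F u * M)"
      using F by simp
    show "(\<lambda>u. F u * g (exp (- u))) \<in> borel_measurable exp_measure"
      using F by measurable
  qed (rule bound)
qed

lemma abs_integral_mult_diff_le:
  fixes F k l :: "'a \<Rightarrow> real"
  assumes F: "integrable M F" "integrable M (\<lambda>u. F u * k u)" "integrable M (\<lambda>u. F u * l u)"
    and d: "AE u in M. \<bar>k u - l u\<bar> \<le> d"
  shows "\<bar>(\<integral>u. F u * k u \<partial>M) - (\<integral>u. F u * l u \<partial>M)\<bar> \<le> d * (\<integral>u. \<bar>F u\<bar> \<partial>M)"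
proof -
  have "\<bar>(\<integral>u. F u * k u \<partial>M) - (\<integral>u. F u * l u \<partial>M)\<bar> \<le> (\<integral>u. \<bar>F u * k u - F u * l u\<bar> \<partial>M)"
    using integral_abs_bound[of M "\<lambda>u. F u * k u - F u * l u"] F(2,3) by simp
  also have "\<dots> \<le> (\<integral>u. d * \<bar>F u\<bar> \<partial>M)"
  proof (rule integral_mono_AE)
    show "AE u in M. \<bar>F u * k u - F u * l u\<bar> \<le> d * \<bar>F u\<bar>"
      using d
    proof eventually_elim
      case (elim u)
      then show ?case
        using mult_right_mono[OF elim abs_ge_zero[of "F u"]]
        by (simp add: mult.commute[of _ "\<bar>F u\<bar>"] flip: abs_mult right_diff_distrib)
    qed
  qed (use F in auto)
  finally show ?thesis by simp
qed

lemma continuous_kernel_tendsto_0: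
  assumes f: "f \<in> borel_measurable borel" "\<And>x. x > 0 \<Longrightarrow> integrable exp_measure (\<lambda>u. f (x * u))"
    and lim: "(abel_mean f \<longlongrightarrow> 0) at_top"
    and bdd: "\<forall>\<^sub>F x in at_top. abel_mean (\<lambda>t. \<bar>f t\<bar>) x \<le> K"
    and g: "continuous_on UNIV g"
  shows "((\<lambda>x. \<integral>u. f (x * u) * g (exp (- u)) \<partial>exp_measure) \<longlongrightarrow> 0) at_top"
proof (rule tendstoI)
  fix e :: real assume e: "e > 0"
  define d where "d = e / (2 * (\<bar>K\<bar> + 1))"
  have d: "d > 0" "d * \<bar>K\<bar> < e / 2"
    using e by (auto simp: d_def field_simps)
  obtain p where p: "real_polynomial_function p" "\<And>v. v \<in> {0..1} \<Longrightarrow> \<bar>g v - p v\<bar> < d"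
    using Stone_Weierstrass_real_polynomial_function[of "{0..1}" g d] d continuous_on_subset[OF g]
    by (metis compact_Icc subset_UNIV)
  have cont_p: "continuous_on UNIV p"
    using continuous_real_polymonial_function[OF p(1)]
    by (rule continuous_at_imp_continuous_on[OF ballI])
  have "((\<lambda>x. \<integral>u. f (x * u) * p (exp (- u)) \<partial>exp_measure) \<longlongrightarrow> 0) at_top"
    using f lim p(1) by (rule polynomial_kernel_tendsto_0)
  from tendstoD[OF this half_gt_zero[OF e]] bdd eventually_gt_at_top[of 0]
  show "\<forall>\<^sub>F x in at_top. dist (\<integral>u. f (x * u) * g (exp (- u)) \<partial>exp_measure) 0 < e"
  proof eventually_elim
    case (elim x)
    have "\<bar>(\<integral>u. f (x * u) * g (exp (- u)) \<partial>exp_measure)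
        - (\<integral>u. f (x * u) * p (exp (- u)) \<partial>exp_measure)\<bar>
        \<le> d * (\<integral>u. \<bar>f (x * u)\<bar> \<partial>exp_measure)"
    proof (intro abs_integral_mult_diff_le integrable_mult_continuous_kernel f(2) g cont_p elim(3))
      show "AE u in exp_measure. \<bar>g (exp (- u)) - p (exp (- u))\<bar> \<le> d"
        using AE_exp_measure_pos by eventually_elim (use p(2) in \<open>auto intro: less_imp_le\<close>)
    qed
    also have "\<dots> \<le> d * \<bar>K\<bar>"
      using elim(2) d by (intro mult_left_mono) (auto simp: abel_mean_def)
    finally show ?case
      using elim(1) d unfolding dist_real_def by linarith
  qed
qed

lemma bump_kernel_exists:
  fixes \<beta> :: real
  assumes "\<beta> > 1"
  obtains g :: "real \<Rightarrow> real" where "continuous_on UNIV g" "\<And>v. g v \<ge> 0"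
    "\<And>u. u \<notin> {1..\<beta>} \<Longrightarrow> g (exp (- u)) = 0" "0 < (\<integral>u. g (exp (- u)) \<partial>exp_measure)"
proof -
  define g where "g v = max 0 ((v - exp (- \<beta>)) * (exp (- 1) - v))" for v :: real
  have cont: "continuous_on UNIV g"
    unfolding g_def by (intro continuous_intros)
  have nonneg: "g v \<ge> 0" for v by (simp add: g_def)
  have supp: "g (exp (- u)) = 0" if "u \<notin> {1..\<beta>}" for u
  proof -
    have "(exp (- u) - exp (- \<beta>)) * (exp (- 1) - exp (- u)) \<le> 0"
      using that assms by (cases "u < 1") (auto simp: mult_le_0_iff)
    then show ?thesis by (simp add: g_def)
  qed
  have pos: "g (exp (- u)) > 0" if "u \<in> {1<..<\<beta>}" for u
    using that by (auto simp: g_def max_def)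
  have int: "integrable exp_measure (\<lambda>u. g (exp (- u)))"
    using integrable_mult_continuous_kernel[OF _ cont, of "\<lambda>_. 1"] by simp
  have "(\<integral>u. g (exp (- u)) \<partial>exp_measure) \<noteq> 0"
  proof
    assume "(\<integral>u. g (exp (- u)) \<partial>exp_measure) = 0"
    then have "AE u in exp_measure. g (exp (- u)) = 0"
      using integral_nonneg_eq_0_iff_AE[OF int] nonneg by simp
    then have "AE u in exp_measure. u \<notin> {1<..<\<beta>}"
      by eventually_elim (use pos in force)
    then have "measure exp_measure {1<..<\<beta>} = 0"
      by (simp add: exp_measure.prob_eq_0)
    moreover have "{1<..<\<beta>} = {1<..} - {\<beta>..}" by auto
    then have "measure exp_measure {1<..<\<beta>} = exp (- 1) - exp (- \<beta>)"
      using assms by (simp add: exp_measure.finite_measure_Diff Ici_subset_Ioi_iff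
        measure_exp_measure_greaterThan measure_exp_measure_atLeast)
    ultimately show False using assms by simp
  qed
  then have "0 < (\<integral>u. g (exp (- u)) \<partial>exp_measure)"
    using Bochner_Integration.integral_nonneg[of exp_measure "\<lambda>u. g (exp (- u))"] nonneg
    by (simp add: less_le)
  then show ?thesis
    using that[of g] cont nonneg supp by blast
qed

lemma weighted_integral_bounds:
  fixes F k :: "'a \<Rightarrow> real"
  assumes k: "integrable M k" "\<And>u. k u \<ge> 0" "\<And>u. u \<notin> S \<Longrightarrow> k u = 0"
    and Fk: "integrable M (\<lambda>u. F u * k u)"
    and F: "\<And>u. u \<in> S \<Longrightarrow> c \<le> F u" "\<And>u. u \<in> S \<Longrightarrow> F u \<le> d"
  shows "c * (\<integral>u. k u \<partial>M) \<le> (\<integral>u. F u * k u \<partial>M)"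
    and "(\<integral>u. F u * k u \<partial>M) \<le> d * (\<integral>u. k u \<partial>M)"
proof -
  have "c * k u \<le> F u * k u \<and> F u * k u \<le> d * k u" for u
    using F[of u] k(2,3)[of u] by (cases "u \<in> S") (auto intro: mult_right_mono)
  then have "(\<integral>u. c * k u \<partial>M) \<le> (\<integral>u. F u * k u \<partial>M)"
    and "(\<integral>u. F u * k u \<partial>M) \<le> (\<integral>u. d * k u \<partial>M)"
    by (intro Bochner_Integration.integral_mono Fk integrable_mult_right k(1); blast)+
  then show "c * (\<integral>u. k u \<partial>M) \<le> (\<integral>u. F u * k u \<partial>M)"
    "(\<integral>u. F u * k u \<partial>M) \<le> d * (\<integral>u. k u \<partial>M)"
    by simp_all
qed

lemma bump_average_bounds:
  fixes f g :: "real \<Rightarrow> real"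
  assumes int: "integrable exp_measure (\<lambda>u. f (x * u))" and "x > 0" "\<beta> > 1"
    and g: "continuous_on UNIV g" "\<And>v. g v \<ge> 0" "\<And>u. u \<notin> {1..\<beta>} \<Longrightarrow> g (exp (- u)) = 0"
    and slow: "\<And>z t. x \<le> z \<Longrightarrow> z \<le> t \<Longrightarrow> t \<le> \<beta> * z \<Longrightarrow> f z - e \<le> f t"
  shows "(f x - e) * (\<integral>u. g (exp (- u)) \<partial>exp_measure)
      \<le> (\<integral>u. f (x * u) * g (exp (- u)) \<partial>exp_measure)" (is ?lower)
    and "(\<integral>u. f (x * u) * g (exp (- u)) \<partial>exp_measure)
      \<le> (f (\<beta> * x) + e) * (\<integral>u. g (exp (- u)) \<partial>exp_measure)" (is ?upper)
proof -
  have "f x - e \<le> f (x * u)" "f (x * u) \<le> f (\<beta> * x) + e" if "u \<in> {1..\<beta>}" for u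
  proof -
    have scaled: "x \<le> x * u" "x * u \<le> \<beta> * x" "\<beta> * x \<le> \<beta> * (x * u)"
      using that \<open>x > 0\<close> \<open>\<beta> > 1\<close> by auto
    show "f x - e \<le> f (x * u)" "f (x * u) \<le> f (\<beta> * x) + e"
      using slow[OF order_refl scaled(1,2)] slow[OF scaled] by simp_all
  qed
  moreover have "integrable exp_measure (\<lambda>u. f (x * u) * g (exp (- u)))"
    using int g(1) by (rule integrable_mult_continuous_kernel)
  moreover have "integrable exp_measure (\<lambda>u. g (exp (- u)))"
    using integrable_mult_continuous_kernel[OF _ g(1), of "\<lambda>_. 1"] by simp
  ultimately show ?lower ?upper
    by (intro weighted_integral_bounds[where S = "{1..\<beta>}"] g; blast)+
qed

theorem karamata_tauberian:
  assumes f: "f \<in> borel_measurable borel" "\<And>x. x > 0 \<Longrightarrow> integrable exp_measure (\<lambda>u. f (x * u))"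
    and lim: "(abel_mean f \<longlongrightarrow> 0) at_top"
    and bdd: "\<forall>\<^sub>F x in at_top. abel_mean (\<lambda>t. \<bar>f t\<bar>) x \<le> K"
    and slow: "slowly_decreasing f"
  shows "(f \<longlongrightarrow> 0) at_top"
proof (rule tendstoI)
  fix e :: real assume e: "e > 0"
  obtain \<beta> X where \<beta>: "\<beta> > 1" and X: "\<And>x t. X \<le> x \<Longrightarrow> x \<le> t \<Longrightarrow> t \<le> \<beta> * x \<Longrightarrow> f x - e / 2 \<le> f t"
    using slow half_gt_zero[OF e] unfolding slowly_decreasing_def eventually_at_top_linorder
    by (metis atLeastAtMost_iff)
  obtain g :: "real \<Rightarrow> real" where g: "continuous_on UNIV g" "\<And>v. g v \<ge> 0"
      "\<And>u. u \<notin> {1..\<beta>} \<Longrightarrow> g (exp (- u)) = 0" "0 < (\<integral>u. g (exp (- u)) \<partial>exp_measure)"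
    using bump_kernel_exists[OF \<beta>] by blast
  define m where "m = (\<integral>u. g (exp (- u)) \<partial>exp_measure)"
  define J where "J x = (\<integral>u. f (x * u) * g (exp (- u)) \<partial>exp_measure)" for x
  have J_bounds: "(f x - e / 2) * m \<le> J x" "J x \<le> (f (\<beta> * x) + e / 2) * m"
    if x: "x \<ge> max X 1" for x
    using bump_average_bounds[of f x \<beta> g "e / 2"] f(2)[of x] \<beta> g(1-3) X x
    unfolding m_def J_def by simp_all
  have J: "(J \<longlongrightarrow> 0) at_top"
    unfolding J_def using f lim bdd g(1) by (rule continuous_kernel_tendsto_0)
  moreover have "filterlim (\<lambda>x. x / \<beta>) at_top at_top"
    using \<beta> by real_asymp
  ultimately have J_rescaled: "((\<lambda>x. J (x / \<beta>)) \<longlongrightarrow> 0) at_top"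
    by (rule filterlim_compose)
  have "e / 2 * m > 0"
    using e g by (simp add: m_def)
  from tendstoD[OF J this] tendstoD[OF J_rescaled this] eventually_ge_at_top[of "max X 1"]
    eventually_ge_at_top[of "\<beta> * max X 1"]
  show "\<forall>\<^sub>F x in at_top. dist (f x) 0 < e"
  proof eventually_elim
    case (elim x)
    have "x / \<beta> \<ge> max X 1"
      using elim(4)
      by (simp only: pos_le_divide_eq[OF order.strict_trans[OF zero_less_one \<beta>]] mult.commute)
    then have "(f x - e / 2) * m < (e / 2) * m" "(- (e / 2)) * m < (f x + e / 2) * m"
      using J_bounds(1)[OF elim(3)] J_bounds(2)[of "x / \<beta>"] elim(1,2) \<beta>
      by (auto simp: algebra_simps)
    then have "f x - e / 2 < e / 2" "- (e / 2) < f x + e / 2"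
      using g(4) unfolding m_def[symmetric] by (simp_all only: mult_less_cancel_right_pos)
    then show ?case by (simp add: dist_real_def)
  qed
qed

lemma slowly_decreasing_mono_diff_ln:
  assumes "mono g"
  shows "slowly_decreasing (\<lambda>t. g t - b * ln t - c)"
  unfolding slowly_decreasing_def
proof (intro allI impI)
  fix e :: real assume "e > 0"
  define \<beta> where "\<beta> = exp (e / (\<bar>b\<bar> + 1))"
  have "\<beta> > 1" "\<bar>b\<bar> * ln \<beta> \<le> e"
    using \<open>e > 0\<close> by (auto simp: \<beta>_def field_simps)
  moreover have "g x - b * ln x - c - e \<le> g t - b * ln t - c" if "x > 0" "t \<in> {x..\<beta> * x}" for x t
  proof -
    have "0 \<le> ln t - ln x" "ln t - ln x \<le> ln \<beta>"
      using that \<open>\<beta> > 1\<close> ln_le_cancel_iff[of t "\<beta> * x"] by (auto simp: ln_mult)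
    then have "b * (ln t - ln x) \<le> \<bar>b\<bar> * ln \<beta>"
      by (intro mult_mono) auto
    then show ?thesis
      using monoD[OF assms, of x t] that \<open>\<bar>b\<bar> * ln \<beta> \<le> e\<close> by (simp add: algebra_simps)
  qed
  ultimately show "\<exists>\<beta>>1. \<forall>\<^sub>F x in at_top. \<forall>t\<in>{x..\<beta> * x}.
      g x - b * ln x - c - e \<le> g t - b * ln t - c"
    by (intro exI[of _ \<beta>] conjI) (auto intro: eventually_mono[OF eventually_gt_at_top[of 0]])
qed

lemma abel_mean_diff_ln:
  fixes g :: "real \<Rightarrow> real"
  assumes "integrable exp_measure (\<lambda>u. g (x * u))" "x > 0"
  shows "abel_mean (\<lambda>t. g t - b * ln t - c) x = abel_mean g x - b * (ln x - euler_mascheroni) - c"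
  using assms integrable_dilate_ln[of x] abel_mean_ln[of x] by (simp add: abel_mean_def)

lemma abel_mean_abs_diff_ln_le:
  fixes g :: "real \<Rightarrow> real"
  assumes "mono g" and int: "\<And>x. x > 0 \<Longrightarrow> integrable exp_measure (\<lambda>u. g (x * u))" and x: "x > 0"
  shows "abel_mean (\<lambda>t. \<bar>g t - b * ln t - d\<bar>) x
    \<le> 2 * (abel_mean g x - abel_mean g (x / 2)) + \<bar>abel_mean g x - b * ln x - d\<bar>
        + \<bar>b\<bar> * (\<integral>u. \<bar>ln u\<bar> \<partial>exp_measure)"
proof -
  have [measurable]: "g \<in> borel_measurable borel"
    using \<open>mono g\<close> by (rule borel_measurable_mono)
  let ?X = "\<lambda>u. g (x * u)" and ?r = "\<bar>abel_mean g x - b * ln x - d\<bar>"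
  have "mono ?X"
    using \<open>mono g\<close> x by (auto simp: mono_def)
  have "(\<integral>u. ?X u * (1 - 2 * exp (- u)) \<partial>exp_measure) = abel_mean g x - abel_mean g (x / 2)"
    using has_bochner_integral_abel_mean_power[of g x 1] int[of "x / 2"] int[of x] x
    by (simp add: has_bochner_integral_iff abel_mean_def right_diff_distrib mult.left_commute)
  with mean_abs_deviation_mono_le[OF \<open>mono ?X\<close> int[OF x]]
  have deviation: "(\<integral>u. \<bar>?X u - abel_mean g x\<bar> \<partial>exp_measure)
      \<le> 2 * (abel_mean g x - abel_mean g (x / 2))"
    by (simp add: abel_mean_def)
  have "abel_mean (\<lambda>t. \<bar>g t - b * ln t - d\<bar>) x
      \<le> (\<integral>u. \<bar>?X u - abel_mean g x\<bar> + (?r + \<bar>b\<bar> * \<bar>ln u\<bar>) \<partial>exp_measure)"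
    unfolding abel_mean_def[of "\<lambda>t. \<bar>g t - b * ln t - d\<bar>"]
  proof (rule integral_mono_AE)
    show "AE u in exp_measure. \<bar>g (x * u) - b * ln (x * u) - d\<bar>
        \<le> \<bar>?X u - abel_mean g x\<bar> + (?r + \<bar>b\<bar> * \<bar>ln u\<bar>)"
      using AE_exp_measure_pos
    proof eventually_elim
      case (elim u)
      have "b * ln (x * u) = b * ln x + b * ln u"
        using x elim by (simp add: ln_mult distrib_left)
      then show ?case
        unfolding abs_mult[symmetric] by linarith
    qed
  qed (use int[OF x] integrable_dilate_ln[OF x] integrable_exp_measure_ln in auto)
  also have "\<dots> = (\<integral>u. \<bar>?X u - abel_mean g x\<bar> \<partial>exp_measure) + (?r + \<bar>b\<bar> * (\<integral>u. \<bar>ln u\<bar> \<partial>exp_measure))"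
    using int[OF x] integrable_exp_measure_ln by simp
  finally show ?thesis
    using deviation by linarith
qed

lemma abel_mean_abs_diff_ln_bounded:
  assumes "mono g" and int: "\<And>x. x > 0 \<Longrightarrow> integrable exp_measure (\<lambda>u. g (x * u))"
    and lim: "((\<lambda>x. abel_mean g x - b * ln x) \<longlongrightarrow> c) at_top"
  obtains K where "\<forall>\<^sub>F x in at_top. abel_mean (\<lambda>t. \<bar>g t - b * ln t - d\<bar>) x \<le> K"
proof -
  define W where "W = (\<integral>u. \<bar>ln u\<bar> \<partial>exp_measure)"
  have "filterlim (\<lambda>x::real. x / 2) at_top at_top"
    by real_asymp
  from filterlim_compose[OF lim this]
  have "((\<lambda>x. 2 * ((abel_mean g x - b * ln x) - (abel_mean g (x / 2) - b * ln (x / 2)) + b * ln 2)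
      + \<bar>(abel_mean g x - b * ln x) - d\<bar> + \<bar>b\<bar> * W)
        \<longlongrightarrow> 2 * (c - c + b * ln 2) + \<bar>c - d\<bar> + \<bar>b\<bar> * W) at_top"
    by (intro tendsto_intros lim)
  from order_tendstoD(2)[OF this less_add_one] eventually_gt_at_top[of 0]
  have "\<forall>\<^sub>F x in at_top. abel_mean (\<lambda>t. \<bar>g t - b * ln t - d\<bar>) x
      \<le> 2 * (c - c + b * ln 2) + \<bar>c - d\<bar> + \<bar>b\<bar> * W + 1"
  proof eventually_elim
    case (elim x)
    have "(abel_mean g x - b * ln x) - (abel_mean g (x / 2) - b * ln (x / 2)) + b * ln 2
        = abel_mean g x - abel_mean g (x / 2)"
      using elim by (simp add: ln_div right_diff_distrib)
    from less_imp_le[OF elim(1)[unfolded this]]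
    show ?case
      using abel_mean_abs_diff_ln_le[OF \<open>mono g\<close> int elim(2), of b d] unfolding W_def
      by (rule order.trans[rotated])
  qed
  then show ?thesis by (rule that)
qed

theorem de_haan_tauberian:
  assumes "mono g" and int: "\<And>x. x > 0 \<Longrightarrow> integrable exp_measure (\<lambda>u. g (x * u))"
    and lim: "((\<lambda>x. abel_mean g x - b * ln x) \<longlongrightarrow> c) at_top"
  shows "((\<lambda>t. g t - b * ln t) \<longlongrightarrow> c + b * euler_mascheroni) at_top"
proof -
  have [measurable]: "g \<in> borel_measurable borel"
    using \<open>mono g\<close> by (rule borel_measurable_mono)
  define d where "d = c + b * euler_mascheroni"
  define f where "f t = g t - b * ln t - d" for t
  obtain K where K: "\<forall>\<^sub>F x in at_top. abel_mean (\<lambda>t. \<bar>f t\<bar>) x \<le> K"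
    unfolding f_def using abel_mean_abs_diff_ln_bounded[OF assms] by blast
  have "((\<lambda>x. abel_mean g x - b * ln x - c) \<longlongrightarrow> 0) at_top"
    using lim by (simp add: LIM_zero)
  then have lim_f: "(abel_mean f \<longlongrightarrow> 0) at_top"
  proof (rule Lim_transform_eventually)
    show "\<forall>\<^sub>F x in at_top. abel_mean g x - b * ln x - c = abel_mean f x"
      using eventually_gt_at_top[of 0] unfolding f_def d_def
      by eventually_elim (subst abel_mean_diff_ln, auto simp: int algebra_simps)
  qed
  have slow: "slowly_decreasing f"
    unfolding f_def using \<open>mono g\<close> by (rule slowly_decreasing_mono_diff_ln)
  have "(f \<longlongrightarrow> 0) at_top"
  proof (rule karamata_tauberian[OF _ _ lim_f K slow])
    show "f \<in> borel_measurable borel"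
      unfolding f_def by measurable
    show "integrable exp_measure (\<lambda>u. f (x * u))" if "x > 0" for x
      unfolding f_def using int integrable_dilate_ln that by simp
  qed
  then show ?thesis
    unfolding f_def d_def by (simp add: LIM_zero_iff)
qed

section \<open>Riemann--Stieltjes integrals\<close>

lemma is_partition_mono:
  assumes "is_partition a b n p" "i \<le> j" "j \<le> n"
  shows "p i \<le> p j"
  using assms(2,3)
proof (induction j rule: dec_induct)
  case (step j)
  then have "p j < p (Suc j)" using assms(1) by (auto simp: is_partition_def)
  then show ?case using step by simp
qed simp

lemma is_partition_in_Icc:
  assumes "is_partition a b n p" "i \<le> n"
  shows "p i \<in> {a..b}"
  using is_partition_mono[OF assms(1), of 0 i] is_partition_mono[OF assms(1), of i n] assms
  by (auto simp: is_partition_def)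

lemma is_partition_extend:
  assumes "is_partition a x n p" "x < y"
  shows "is_partition a y (Suc n) (p(Suc n := y))"
  using assms by (auto simp: is_partition_def less_Suc_eq)

lemma is_partition_equidistant:
  assumes "a < b" "n > 0"
  shows "is_partition a b n (\<lambda>i. a + real i * ((b - a) / real n))"
  using assms by (simp add: is_partition_def divide_strict_right_mono)

lemma fine_partition_exists:
  assumes "a \<le> b" "\<delta> > 0"
  obtains n p where "is_partition a b n p" "\<And>i. i < n \<Longrightarrow> p (Suc i) - p i < \<delta>"
proof (cases "a = b")
  case True
  have "is_partition a b 0 (\<lambda>_. a)" using True by (simp add: is_partition_def)
  then show ?thesis using that by blast
next
  case False
  then have ab: "a < b" using assms by simp
  obtain n where n: "(b - a) / \<delta> < real n" using reals_Archimedean2 by blast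
  moreover have "(b - a) / \<delta> > 0" using ab assms by simp
  ultimately have "n > 0"
    by (metis less_trans of_nat_0_less_iff)
  define h where "h = (b - a) / real n"
  have "h < \<delta>"
    using n \<open>n > 0\<close> assms by (simp add: h_def field_simps)
  then show ?thesis
    using that[OF is_partition_equidistant[OF ab \<open>n > 0\<close>, folded h_def]]
    by (simp add: distrib_right)
qed

lemma sum_integral_partition:
  fixes f :: "real \<Rightarrow> real"
  assumes p: "is_partition a b n p" and f: "f integrable_on {a..b}"
  shows "(\<Sum>i<n. integral {p i..p (Suc i)} f) = integral {a..b} f"
proof -
  have "(\<Sum>i<m. integral {p i..p (Suc i)} f) = integral {a..p m} f" if "m \<le> n" for m
    using that
  proof (induction m)
    case 0
    then show ?case using p by (simp add: is_partition_def)
  next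
    case (Suc m)
    have "integral {a..p m} f + integral {p m..p (Suc m)} f = integral {a..p (Suc m)} f"
      using Suc.prems is_partition_in_Icc[OF p, of m] is_partition_in_Icc[OF p, of "Suc m"]
        is_partition_mono[OF p, of m "Suc m"]
      by (intro Henstock_Kurzweil_Integration.integral_combine integrable_subinterval_real[OF f])
        auto
    then show ?case using Suc by simp
  qed
  then show ?thesis
    using p by (simp add: is_partition_def)
qed

definition tagged_partition_fine ::
    "real \<Rightarrow> real \<Rightarrow> real \<Rightarrow> nat \<Rightarrow> (nat \<Rightarrow> real) \<Rightarrow> (nat \<Rightarrow> real) \<Rightarrow> bool" where
  "tagged_partition_fine a b \<delta> n p \<xi> \<longleftrightarrow> is_partition a b n p \<and>
     (\<forall>i<n. p i \<le> \<xi> i \<and> \<xi> i \<le> p (Suc i)) \<and> (\<forall>i<n. p (Suc i) - p i < \<delta>)"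

definition RS_sum ::
    "(real \<Rightarrow> real) \<Rightarrow> (real \<Rightarrow> real) \<Rightarrow> nat \<Rightarrow> (nat \<Rightarrow> real) \<Rightarrow> (nat \<Rightarrow> real) \<Rightarrow> real" where
  "RS_sum \<phi> s n p \<xi> = (\<Sum>i<n. \<phi> (\<xi> i) * (s (p (Suc i)) - s (p i)))"

lemma has_RS_integral_altdef:
  "has_RS_integral \<phi> s a b I \<longleftrightarrow>
    (\<forall>\<epsilon>>0. \<exists>\<delta>>0. \<forall>n p \<xi>. tagged_partition_fine a b \<delta> n p \<xi> \<longrightarrow> \<bar>RS_sum \<phi> s n p \<xi> - I\<bar> < \<epsilon>)"
  unfolding has_RS_integral_def tagged_partition_fine_def RS_sum_def ..

lemma tagged_partition_fine_exists:
  assumes "a \<le> b" "\<delta> > 0"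
  obtains n p \<xi> where "tagged_partition_fine a b \<delta> n p \<xi>"
proof -
  obtain n p where p: "is_partition a b n p" "\<And>i. i < n \<Longrightarrow> p (Suc i) - p i < \<delta>"
    using fine_partition_exists[OF assms] by metis
  then have "tagged_partition_fine a b \<delta> n p p"
    using is_partition_mono[OF p(1)] by (simp add: tagged_partition_fine_def)
  then show ?thesis by (rule that)
qed

lemma tagged_partition_fine_mono:
  "tagged_partition_fine a b \<delta> n p \<xi> \<Longrightarrow> \<delta> \<le> \<delta>' \<Longrightarrow> tagged_partition_fine a b \<delta>' n p \<xi>"
  by (fastforce simp: tagged_partition_fine_def)

definition variation_majorant_on :: "real set \<Rightarrow> (real \<Rightarrow> real) \<Rightarrow> (real \<Rightarrow> real) \<Rightarrow> bool" where
  "variation_majorant_on S s V \<longleftrightarrow> (\<forall>x\<in>S. \<forall>y\<in>S. x \<le> y \<longrightarrow> \<bar>s y - s x\<bar> \<le> V y - V x)"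

lemma variation_majorant_onD:
  "variation_majorant_on S s V \<Longrightarrow> x \<in> S \<Longrightarrow> y \<in> S \<Longrightarrow> x \<le> y \<Longrightarrow> \<bar>s y - s x\<bar> \<le> V y - V x"
  by (simp add: variation_majorant_on_def)

lemma variation_majorant_on_subset:
  "variation_majorant_on S s V \<Longrightarrow> T \<subseteq> S \<Longrightarrow> variation_majorant_on T s V"
  by (auto simp: variation_majorant_on_def)

lemma
  assumes "variation_majorant_on UNIV s V"
  shows borel_measurable_variation_majorant: "s \<in> borel_measurable borel"
    and locally_bounded_variation_majorant: "locally_bounded s"
proof -
  have mono: "mono V" "mono (\<lambda>t. V t - s t)"
    using variation_majorant_onD[OF assms] by (fastforce intro!: monoI)+
  have "(\<lambda>t. V t - (V t - s t)) \<in> borel_measurable borel" "locally_bounded (\<lambda>t. V t - (V t - s t))"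
    by (intro borel_measurable_diff borel_measurable_mono locally_bounded_diff
        locally_bounded_mono mono)+
  then show "s \<in> borel_measurable borel" "locally_bounded s"
    by simp_all
qed

lemma variation_majorant_on_atLeast_exists:
  assumes "locally_bounded_variation s"
  obtains V where "variation_majorant_on {a..} s V"
proof -
  define S where "S x = {(\<Sum>i<n. \<bar>s (p (Suc i)) - s (p i)\<bar>) |n p. is_partition a x n p}" for x
  have bdd: "bdd_above (S x)" if "a \<le> x" for x
    using assms that
    unfolding locally_bounded_variation_def bounded_variation_on_def S_def bdd_above_def
    by blast
  have "\<bar>s y - s x\<bar> \<le> Sup (S y) - Sup (S x)" if "a \<le> x" "x < y" for x y
  proof -
    have "v \<le> Sup (S y) - \<bar>s y - s x\<bar>" if v: "v \<in> S x" for v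
    proof -
      obtain n p where v_eq: "v = (\<Sum>i<n. \<bar>s (p (Suc i)) - s (p i)\<bar>)" and p: "is_partition a x n p"
        using v by (auto simp: S_def)
      define q where "q = p(Suc n := y)"
      have "(\<Sum>i<Suc n. \<bar>s (q (Suc i)) - s (q i)\<bar>) \<in> S y"
        using is_partition_extend[OF p \<open>x < y\<close>] unfolding S_def q_def by blast
      moreover have "(\<Sum>i<Suc n. \<bar>s (q (Suc i)) - s (q i)\<bar>) = v + \<bar>s y - s x\<bar>"
        using p by (simp add: v_eq q_def is_partition_def)
      ultimately show ?thesis
        using bdd[of y] \<open>a \<le> x\<close> \<open>x < y\<close> cSup_upper by fastforce
    qed
    moreover obtain n p where "is_partition a x n p"
      using fine_partition_exists[OF \<open>a \<le> x\<close> zero_less_one] by metis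
    then have "S x \<noteq> {}"
      unfolding S_def by blast
    ultimately have "Sup (S x) \<le> Sup (S y) - \<bar>s y - s x\<bar>"
      by (intro cSup_least) auto
    then show ?thesis by simp
  qed
  then have "variation_majorant_on {a..} s (\<lambda>x. Sup (S x))"
    by (auto simp: variation_majorant_on_def le_less)
  then show ?thesis by (rule that)
qed

lemma variation_majorant_exists:
  assumes "locally_bounded_variation s" and const: "\<And>x. x < a \<Longrightarrow> s x = c"
  obtains V where "variation_majorant_on UNIV s V"
proof -
  obtain V where V: "variation_majorant_on {a - 1..} s V"
    using variation_majorant_on_atLeast_exists[OF assms(1)] by blast
  have frozen: "s (max x (a - 1)) = s x" for x
    by (auto simp: max_def const)
  have "\<bar>s y - s x\<bar> \<le> V (max y (a - 1)) - V (max x (a - 1))" if "x \<le> y" for x y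
  proof -
    have "max x (a - 1) \<le> max y (a - 1)"
      using that by (rule max.mono) (rule order_refl)
    from variation_majorant_onD[OF V _ _ this] show ?thesis
      by (simp only: frozen atLeast_iff max.cobounded2 simp_thms)
  qed
  then have "variation_majorant_on UNIV s (\<lambda>x. V (max x (a - 1)))"
    unfolding variation_majorant_on_def by blast
  then show ?thesis by (rule that)
qed

lemma has_RS_integral_unique:
  assumes ab: "a \<le> b" and I: "has_RS_integral \<phi> s a b I" and J: "has_RS_integral \<phi> s a b J"
  shows "I = J"
proof (rule ccontr)
  assume "I \<noteq> J"
  define \<epsilon> where "\<epsilon> = \<bar>I - J\<bar> / 2"
  have \<epsilon>: "\<epsilon> > 0" using \<open>I \<noteq> J\<close> by (simp add: \<epsilon>_def)
  obtain d where d: "d > 0" "\<And>n p \<xi>. tagged_partition_fine a b d n p \<xi> \<Longrightarrow> \<bar>RS_sum \<phi> s n p \<xi> - I\<bar> < \<epsilon>"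
    using I \<epsilon> unfolding has_RS_integral_altdef by blast
  obtain e where e: "e > 0" "\<And>n p \<xi>. tagged_partition_fine a b e n p \<xi> \<Longrightarrow> \<bar>RS_sum \<phi> s n p \<xi> - J\<bar> < \<epsilon>"
    using J \<epsilon> unfolding has_RS_integral_altdef by blast
  obtain n p \<xi> where "tagged_partition_fine a b (min d e) n p \<xi>"
    using tagged_partition_fine_exists[OF ab, of "min d e"] d(1) e(1) by auto
  then have "\<bar>RS_sum \<phi> s n p \<xi> - I\<bar> < \<epsilon>" "\<bar>RS_sum \<phi> s n p \<xi> - J\<bar> < \<epsilon>"
    by (auto intro!: d(2) e(2) elim: tagged_partition_fine_mono)
  then have "\<bar>I - J\<bar> < 2 * \<epsilon>" by linarith
  then show False by (simp add: \<epsilon>_def)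
qed

lemma RS_integral_eq:
  assumes "a \<le> b" "has_RS_integral \<phi> s a b I"
  shows "RS_integral \<phi> s a b = I"
  unfolding RS_integral_def using assms has_RS_integral_unique by blast

definition by_parts_integral ::
    "(real \<Rightarrow> real) \<Rightarrow> (real \<Rightarrow> real) \<Rightarrow> (real \<Rightarrow> real) \<Rightarrow> real \<Rightarrow> real \<Rightarrow> real" where
  "by_parts_integral \<phi> \<phi>' s a b = \<phi> b * s b - \<phi> a * s a - integral {a..b} (\<lambda>t. s t * \<phi>' t)"

lemma sum_by_parts_integral_partition:
  assumes p: "is_partition a b n p" and "(\<lambda>t. s t * \<phi>' t) integrable_on {a..b}"
  shows "(\<Sum>i<n. by_parts_integral \<phi> \<phi>' s (p i) (p (Suc i))) = by_parts_integral \<phi> \<phi>' s a b"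
  using sum_lessThan_telescope[of "\<lambda>i. \<phi> (p i) * s (p i)" n] sum_integral_partition[OF assms] p
  by (simp add: by_parts_integral_def sum_subtractf is_partition_def)

lemma RS_summand_by_parts:
  fixes \<phi> s V :: "real \<Rightarrow> real"
  assumes \<xi>: "p \<le> \<xi>" "\<xi> \<le> q" and V: "variation_majorant_on {p..q} s V"
    and der: "\<And>t. t \<in> {p..q} \<Longrightarrow> (\<phi> has_real_derivative \<phi>' t) (at t within {p..q})"
    and K: "\<And>t. t \<in> {p..q} \<Longrightarrow> \<bar>\<phi>' t\<bar> \<le> K"
    and int: "(\<lambda>t. s t * \<phi>' t) integrable_on {p..q}"
  shows "\<bar>\<phi> \<xi> * (s q - s p) - by_parts_integral \<phi> \<phi>' s p q\<bar> \<le> 2 * K * (q - p) * (V q - V p)"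
proof -
  let ?D = "s q * (\<phi> q - \<phi> p) - integral {p..q} (\<lambda>t. s t * \<phi>' t)"
  have pq: "p \<le> q" using \<xi> by simp
  have K_nonneg: "K \<ge> 0" using K[of p] pq by auto
  have increment: "\<bar>s q - s p\<bar> \<le> V q - V p" using variation_majorant_onD[OF V] pq by auto
  have "norm (\<phi> \<xi> - \<phi> p) \<le> K * norm (\<xi> - p)"
    using \<xi> K by (intro field_differentiable_bound[of "{p..q}" \<phi> \<phi>']) (auto intro!: der)
  also have "\<dots> \<le> K * (q - p)"
    using \<xi> K_nonneg by (intro mult_left_mono) auto
  finally have tag: "\<bar>(\<phi> \<xi> - \<phi> p) * (s q - s p)\<bar> \<le> K * (q - p) * (V q - V p)"
    unfolding abs_mult using increment pq K_nonneg by (intro mult_mono) auto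
  have "(\<phi>' has_integral (\<phi> q - \<phi> p)) {p..q}"
    using pq der by (intro fundamental_theorem_of_calculus)
      (auto simp flip: has_real_derivative_iff_has_vector_derivative)
  then have "((\<lambda>t. s q * \<phi>' t - s t * \<phi>' t) has_integral ?D) {p..q}"
    by (intro has_integral_diff has_integral_mult_right integrable_integral[OF int])
  moreover have "norm (s q * \<phi>' t - s t * \<phi>' t) \<le> K * (V q - V p)" if t: "t \<in> {p..q}" for t
  proof -
    have "\<bar>s q - s t\<bar> \<le> V q - V t" "\<bar>s t - s p\<bar> \<le> V t - V p"
      using variation_majorant_onD[OF V] t by auto
    then have "\<bar>\<phi>' t\<bar> * \<bar>s q - s t\<bar> \<le> K * (V q - V p)"
      using K[OF t] K_nonneg by (intro mult_mono) auto
    then show ?thesis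
      unfolding left_diff_distrib[symmetric] real_norm_def abs_mult by (simp only: mult.commute)
  qed
  ultimately have "norm ?D \<le> K * (V q - V p) * measure lborel {p..q}"
    using K_nonneg increment
    by (intro has_integral_bound_real[where f = "\<lambda>t. s q * \<phi>' t - s t * \<phi>' t" and S = "{}"]) auto
  then have "\<bar>?D\<bar> \<le> K * (q - p) * (V q - V p)"
    using pq by (simp add: mult_ac)
  moreover have "\<phi> \<xi> * (s q - s p) - by_parts_integral \<phi> \<phi>' s p q = (\<phi> \<xi> - \<phi> p) * (s q - s p) - ?D"
    by (simp add: by_parts_integral_def algebra_simps)
  ultimately show ?thesis using tag by linarith
qed

lemma RS_sum_by_parts:
  fixes \<phi> s V :: "real \<Rightarrow> real"
  assumes V: "variation_majorant_on {a..b} s V"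
    and der: "\<And>t. t \<in> {a..b} \<Longrightarrow> (\<phi> has_real_derivative \<phi>' t) (at t within {a..b})"
    and K: "\<And>t. t \<in> {a..b} \<Longrightarrow> \<bar>\<phi>' t\<bar> \<le> K"
    and int: "(\<lambda>t. s t * \<phi>' t) integrable_on {a..b}"
    and fine: "tagged_partition_fine a b \<delta> n p \<xi>"
  shows "\<bar>RS_sum \<phi> s n p \<xi> - by_parts_integral \<phi> \<phi>' s a b\<bar> \<le> 2 * K * \<delta> * (V b - V a)"
proof -
  let ?S = "\<lambda>i. \<phi> (\<xi> i) * (s (p (Suc i)) - s (p i))"
  let ?R = "\<lambda>i. by_parts_integral \<phi> \<phi>' s (p i) (p (Suc i))"
  have p: "is_partition a b n p" and \<xi>: "\<And>i. i < n \<Longrightarrow> p i \<le> \<xi> i \<and> \<xi> i \<le> p (Suc i)"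
    and mesh: "\<And>i. i < n \<Longrightarrow> p (Suc i) - p i < \<delta>"
    using fine by (auto simp: tagged_partition_fine_def)
  have "\<bar>RS_sum \<phi> s n p \<xi> - by_parts_integral \<phi> \<phi>' s a b\<bar> = \<bar>\<Sum>i<n. ?S i - ?R i\<bar>"
    unfolding sum_by_parts_integral_partition[OF p int, symmetric] RS_sum_def sum_subtractf ..
  also have "\<dots> \<le> (\<Sum>i<n. \<bar>?S i - ?R i\<bar>)"
    by (rule sum_abs)
  also have "\<dots> \<le> (\<Sum>i<n. 2 * K * \<delta> * (V (p (Suc i)) - V (p i)))"
  proof (rule sum_mono)
    fix i assume "i \<in> {..<n}"
    then have i: "i < n" by simp
    then have ab: "p i \<in> {a..b}" "p (Suc i) \<in> {a..b}" "p i \<le> p (Suc i)"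
      using is_partition_in_Icc[OF p] is_partition_mono[OF p] by auto
    then have sub: "{p i..p (Suc i)} \<subseteq> {a..b}" by auto
    have "\<bar>?S i - ?R i\<bar> \<le> 2 * K * (p (Suc i) - p i) * (V (p (Suc i)) - V (p i))"
      using \<xi>[OF i] sub K
      by (intro RS_summand_by_parts variation_majorant_on_subset[OF V sub]
          integrable_subinterval_real[OF int sub] DERIV_subset[OF der sub]) auto
    also have "\<dots> \<le> 2 * K * \<delta> * (V (p (Suc i)) - V (p i))"
      using mesh[OF i] K[OF ab(1)] variation_majorant_onD[OF V ab]
      by (intro mult_right_mono mult_left_mono) auto
    finally show "\<bar>?S i - ?R i\<bar> \<le> 2 * K * \<delta> * (V (p (Suc i)) - V (p i))" .
  qed
  also have "\<dots> = 2 * K * \<delta> * (V b - V a)"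
    using sum_lessThan_telescope[of "\<lambda>i. V (p i)" n] p
    by (simp add: is_partition_def flip: sum_distrib_left)
  finally show ?thesis .
qed

theorem has_RS_integral_by_parts:
  fixes \<phi> s V :: "real \<Rightarrow> real"
  assumes ab: "a \<le> b" and V: "variation_majorant_on {a..b} s V"
    and der: "\<And>t. t \<in> {a..b} \<Longrightarrow> (\<phi> has_real_derivative \<phi>' t) (at t within {a..b})"
    and K: "\<And>t. t \<in> {a..b} \<Longrightarrow> \<bar>\<phi>' t\<bar> \<le> K"
    and int: "(\<lambda>t. s t * \<phi>' t) integrable_on {a..b}"
  shows "has_RS_integral \<phi> s a b (by_parts_integral \<phi> \<phi>' s a b)"
  unfolding has_RS_integral_altdef
proof (intro allI impI)
  fix \<epsilon> :: real assume "\<epsilon> > 0"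
  define c where "c = 2 * K * (V b - V a)"
  have "c \<ge> 0"
    using K[of a] variation_majorant_onD[OF V, of a b] ab by (auto simp: c_def)
  then have \<delta>: "\<epsilon> / (c + 1) > 0" "2 * K * (\<epsilon> / (c + 1)) * (V b - V a) < \<epsilon>"
    using \<open>\<epsilon> > 0\<close> by (auto simp: c_def field_simps)
  have "\<bar>RS_sum \<phi> s n p \<xi> - by_parts_integral \<phi> \<phi>' s a b\<bar> < \<epsilon>"
    if "tagged_partition_fine a b (\<epsilon> / (c + 1)) n p \<xi>" for n p \<xi>
    by (rule order.strict_trans1[OF RS_sum_by_parts[OF V _ _ int that] \<delta>(2)]) (use der K in auto)
  then show "\<exists>\<delta>>0. \<forall>n p \<xi>. tagged_partition_fine a b \<delta> n p \<xi> \<longrightarrow>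
      \<bar>RS_sum \<phi> s n p \<xi> - by_parts_integral \<phi> \<phi>' s a b\<bar> < \<epsilon>"
    using \<delta>(1) by blast
qed

section \<open>Cesaro limits\<close>

lemma integrable_on_continuous_mult_locally_bounded:
  fixes h G :: "real \<Rightarrow> real"
  assumes "continuous_on {0..x} h" "G \<in> borel_measurable borel" "locally_bounded G"
  shows "(\<lambda>t. h t * G t) integrable_on {0..x}"
proof -
  have "(\<lambda>t. G t * h t) absolutely_integrable_on {0..x}"
    using assms
    by (intro absolutely_integrable_bounded_measurable_product_real
        absolutely_integrable_continuous_real measurable_restrict_space1 measurable_completion)
       (auto simp: locally_bounded_def)
  then show ?thesis
    by (simp add: absolutely_integrable_on_def mult.commute)
qed

lemma iter_integral_Suc:
  "iter_integral G (Suc j) x = integral {0..x} (\<lambda>t. (x - t) ^ j * G t) / fact j"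
  by (simp add: iter_integral_def)

lemma has_integral_power_diff:
  fixes x :: real
  assumes "0 \<le> x"
  shows "((\<lambda>t. (x - t) ^ j) has_integral (x ^ Suc j / real (Suc j))) {0..x}"
proof -
  have "((\<lambda>t. (x - t) ^ j) has_integral (- ((x - x) ^ Suc j / real (Suc j))
      - (- ((x - 0) ^ Suc j / real (Suc j))))) {0..x}"
    using assms by (intro fundamental_theorem_of_calculus)
      (auto simp flip: has_real_derivative_iff_has_vector_derivative
        intro!: derivative_eq_intros simp del: of_nat_Suc power_Suc)
  then show ?thesis by simp
qed

lemma iter_integral_diff_const:
  assumes G: "G \<in> borel_measurable borel" "locally_bounded G" and "0 \<le> x"
  shows "iter_integral (\<lambda>t. G t - c) k x = iter_integral G k x - c * x ^ k / fact k"
proof (cases k)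
  case 0
  then show ?thesis by (simp add: iter_integral_def)
next
  case (Suc j)
  have "((\<lambda>t. (x - t) ^ j * G t - c * (x - t) ^ j) has_integral
      (integral {0..x} (\<lambda>t. (x - t) ^ j * G t) - c * (x ^ Suc j / real (Suc j)))) {0..x}"
    by (intro has_integral_diff has_integral_mult_right has_integral_power_diff assms(3)
        integrable_integral integrable_on_continuous_mult_locally_bounded G continuous_intros)
  from integral_unique[OF this]
  have "integral {0..x} (\<lambda>t. (x - t) ^ j * (G t - c))
      = integral {0..x} (\<lambda>t. (x - t) ^ j * G t) - c * (x ^ Suc j / real (Suc j))"
    by (simp only: right_diff_distrib mult.commute[of c])
  then show ?thesis
    unfolding Suc iter_integral_Suc by (simp only: diff_divide_distrib fact_Suc) simp
qed

lemma cesaro_lim_diff_const: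
  assumes "cesaro_lim G k l" and G: "G \<in> borel_measurable borel" "locally_bounded G"
  shows "cesaro_lim (\<lambda>t. G t - c) k (l - c)"
  unfolding cesaro_lim_def
proof (rule landau_o.small.in_cong[THEN iffD2])
  show "\<forall>\<^sub>F x in at_top. iter_integral (\<lambda>t. G t - c) k x - (l - c) * x ^ k / fact k
      = iter_integral G k x - l * x ^ k / fact k"
    using eventually_ge_at_top[of 0]
    by eventually_elim (simp add: iter_integral_diff_const[OF G] left_diff_distrib
        diff_divide_distrib)
  show "(\<lambda>x. iter_integral G k x - l * x ^ k / fact k) \<in> o(\<lambda>x. x ^ k)"
    using assms(1) by (simp add: cesaro_lim_def)
qed

lemma cesaro_lim_uminus:
  assumes "cesaro_lim G k l"
  shows "cesaro_lim (\<lambda>x. - G x) k (- l)"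
proof -
  have "(\<lambda>x. - (iter_integral G k x - l * x ^ k / fact k)) \<in> o[at_top](\<lambda>x. x ^ k)"
    using assms unfolding cesaro_lim_def by (subst landau_o.small.uminus_in_iff)
  moreover have "iter_integral (\<lambda>x. - G x) k x = - iter_integral G k x" for x
    by (simp add: iter_integral_def)
  ultimately show ?thesis
    unfolding cesaro_lim_def by (simp add: algebra_simps)
qed

lemma cesaro_lim_cong:
  assumes "\<And>x. x \<ge> 0 \<Longrightarrow> F x = G x"
  shows "cesaro_lim F k l \<longleftrightarrow> cesaro_lim G k l"
proof -
  have "iter_integral F k x = iter_integral G k x" if "x \<ge> 0" for x
    using assms that by (auto simp: iter_integral_def intro!: integral_cong)
  then show ?thesis
    unfolding cesaro_lim_def
    by (intro landau_o.small.in_cong eventually_mono[OF eventually_ge_at_top[of 0]]) auto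
qed

lemma cesaro_lim_imp_tendsto:
  assumes "cesaro_lim G k l"
  shows "((\<lambda>x. iter_integral G k x / x ^ k) \<longlongrightarrow> l / fact k) at_top"
proof -
  have "((\<lambda>x. (iter_integral G k x - l * x ^ k / fact k) / x ^ k + l / fact k)
      \<longlongrightarrow> 0 + l / fact k) at_top"
    using assms unfolding cesaro_lim_def by (intro tendsto_add tendsto_const smalloD_tendsto)
  then have "((\<lambda>x. (iter_integral G k x - l * x ^ k / fact k) / x ^ k + l / fact k)
      \<longlongrightarrow> l / fact k) at_top"
    by simp
  then show ?thesis
  proof (rule Lim_transform_eventually)
    show "\<forall>\<^sub>F x in at_top. (iter_integral G k x - l * x ^ k / fact k) / x ^ k + l / fact k
        = iter_integral G k x / x ^ k"
      using eventually_gt_at_top[of 0] by eventually_elim (simp add: field_simps)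
  qed
qed

lemma iter_integral_lower_bound:
  assumes G: "G \<in> borel_measurable borel" "locally_bounded G" and nonneg: "\<And>t. X \<le> t \<Longrightarrow> 0 \<le> G t"
    and X: "0 \<le> X" and M: "M \<ge> 0" "\<And>t. 0 \<le> t \<Longrightarrow> t \<le> X \<Longrightarrow> \<bar>G t\<bar> \<le> M" and "X \<le> x"
  shows "- (M * X / fact j) * x ^ j \<le> iter_integral G (Suc j) x"
proof -
  let ?h = "\<lambda>t. (x - t) ^ j * G t"
  have h: "?h integrable_on {0..x}"
    by (intro integrable_on_continuous_mult_locally_bounded G continuous_intros)
  have "- (x ^ j * M) * X = integral {0..X} (\<lambda>_. - (x ^ j * M))"
    using X by simp
  also have "\<dots> \<le> integral {0..X} ?h"
  proof (rule integral_le)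
    show "?h integrable_on {0..X}"
      using \<open>X \<le> x\<close> by (intro integrable_subinterval_real[OF h]) auto
    fix t assume t: "t \<in> {0..X}"
    have "\<bar>?h t\<bar> \<le> x ^ j * M"
      unfolding abs_mult using t M(2)[of t] \<open>X \<le> x\<close> M(1)
      by (intro mult_mono) (auto simp: power_abs intro!: power_mono)
    then show "- (x ^ j * M) \<le> ?h t" by linarith
  qed (rule integrable_continuous_real[OF continuous_on_const])
  also have "0 \<le> integral {X..x} ?h"
    using X nonneg by (intro integral_nonneg integrable_subinterval_real[OF h]) auto
  then have "integral {0..X} ?h \<le> integral {0..x} ?h"
    using Henstock_Kurzweil_Integration.integral_combine[OF X \<open>X \<le> x\<close> h] by linarith
  finally show ?thesis
    by (simp add: iter_integral_Suc field_simps)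
qed

lemma cesaro_lim_nonneg:
  assumes G: "G \<in> borel_measurable borel" "locally_bounded G"
    and ces: "cesaro_lim G k l" and nonneg: "\<forall>\<^sub>F x in at_top. 0 \<le> G x"
  shows "0 \<le> l"
proof (cases k)
  case 0
  then have "(G \<longlongrightarrow> l) at_top"
    using cesaro_lim_imp_tendsto[OF ces] by (simp add: iter_integral_def)
  then show ?thesis using nonneg by (rule tendsto_lowerbound) simp
next
  case (Suc j)
  obtain X where X: "X \<ge> 0" "\<And>x. x \<ge> X \<Longrightarrow> 0 \<le> G x"
    using nonneg unfolding eventually_at_top_linorder by (metis max.bounded_iff max.cobounded2)
  obtain M where M: "M \<ge> 0" "\<And>t. 0 \<le> t \<Longrightarrow> t \<le> X \<Longrightarrow> \<bar>G t\<bar> \<le> M"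
    using locally_boundedE[OF G(2)] by blast
  have "((\<lambda>x. iter_integral G k x / x ^ k + (M * X / fact j) / x) \<longlongrightarrow> l / fact k + 0) at_top"
    by (intro tendsto_add cesaro_lim_imp_tendsto[OF ces]) real_asymp
  moreover have "\<forall>\<^sub>F x in at_top. 0 \<le> iter_integral G k x / x ^ k + (M * X / fact j) / x"
    using eventually_ge_at_top[of X] eventually_gt_at_top[of 0]
  proof eventually_elim
    case (elim x)
    have "- (M * X / fact j) * x ^ j / x ^ k \<le> iter_integral G k x / x ^ k"
      unfolding Suc using iter_integral_lower_bound[OF G X(2,1) M elim(1)] elim(2)
      by (intro divide_right_mono) auto
    then show ?case
      using elim(2) by (simp add: Suc)
  qed
  ultimately have "0 \<le> l / fact k + 0"
    by (rule tendsto_lowerbound) simp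
  then have "0 \<le> l / fact k * fact k"
    by (intro mult_nonneg_nonneg) auto
  then show ?thesis by simp
qed

lemma cesaro_lim_lower_bound:
  assumes G: "G \<in> borel_measurable borel" "locally_bounded G"
    and ces: "cesaro_lim G k l" and K: "\<forall>\<^sub>F x in at_top. K \<le> G x"
  shows "K \<le> l"
proof -
  have "0 \<le> l - K"
  proof (rule cesaro_lim_nonneg)
    show "cesaro_lim (\<lambda>t. G t - K) k (l - K)"
      using ces G by (rule cesaro_lim_diff_const)
    show "locally_bounded (\<lambda>t. G t - K)"
      using G(2) locally_bounded_const by (rule locally_bounded_diff)
    show "\<forall>\<^sub>F x in at_top. 0 \<le> G x - K"
      using K by eventually_elim simp
  qed (use G(1) in measurable)
  then show ?thesis by simp
qed

lemma cesaro_lim_ge_limit: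
  assumes G: "G \<in> borel_measurable borel" "locally_bounded G"
    and ces: "cesaro_lim G k l" and lim: "(G \<longlongrightarrow> g) at_top"
  shows "g \<le> l"
proof (rule field_le_epsilon)
  fix e :: real assume "e > 0"
  then have "\<forall>\<^sub>F x in at_top. g - e \<le> G x"
    using order_tendstoD(1)[OF lim, of "g - e"] by (auto elim: eventually_mono)
  then show "g \<le> l + e"
    using cesaro_lim_lower_bound[OF G ces] by force
qed

lemma cesaro_lim_unique:
  assumes G: "G \<in> borel_measurable borel" "locally_bounded G"
    and ces: "cesaro_lim G k l" and lim: "(G \<longlongrightarrow> g) at_top"
  shows "l = g"
proof -
  have "locally_bounded (\<lambda>x. - G x)"
    using locally_bounded_diff[OF locally_bounded_const[of 0] G(2)] by simp
  then have "- g \<le> - l"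
    using borel_measurable_uminus[OF G(1)] cesaro_lim_uminus[OF ces] tendsto_minus[OF lim]
    by (intro cesaro_lim_ge_limit)
  then show ?thesis
    using cesaro_lim_ge_limit[OF G ces lim] by simp
qed

section \<open>Laplace--Stieltjes integrals\<close>

text \<open>With \<open>T\<close> exponentially distributed of rate \<open>y\<close>, this is the mean of \<open>f (min T x)\<close>.\<close>

definition stopped_mean :: "(real \<Rightarrow> real) \<Rightarrow> real \<Rightarrow> real \<Rightarrow> real" where
  "stopped_mean f y x = (\<integral>u. f (min (u / y) x) \<partial>exp_measure)"

lemma stopped_mean_measurable [measurable]:
  assumes [measurable]: "f \<in> borel_measurable borel"
  shows "stopped_mean f y \<in> borel_measurable borel"
  unfolding stopped_mean_def[abs_def] by measurable

lemma
  assumes f: "f \<in> borel_measurable borel" "locally_bounded f" and "y > 0" "x \<ge> 0"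
  shows integrable_stopped: "integrable exp_measure (\<lambda>u. f (min (u / y) x))"
    and abs_stopped_mean_le: "(\<And>t. 0 \<le> t \<Longrightarrow> t \<le> x \<Longrightarrow> \<bar>f t\<bar> \<le> K) \<Longrightarrow> \<bar>stopped_mean f y x\<bar> \<le> K"
proof -
  note [measurable] = f(1)
  have bound: "AE u in exp_measure. \<bar>f (min (u / y) x)\<bar> \<le> K"
    if "\<And>t. 0 \<le> t \<Longrightarrow> t \<le> x \<Longrightarrow> \<bar>f t\<bar> \<le> K" for K
    using AE_exp_measure_pos by eventually_elim (use assms(3,4) in \<open>auto intro!: that\<close>)
  show int: "integrable exp_measure (\<lambda>u. f (min (u / y) x))"
  proof -
    obtain K where "\<And>t. 0 \<le> t \<Longrightarrow> t \<le> x \<Longrightarrow> \<bar>f t\<bar> \<le> K"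
      using locally_boundedE[OF f(2)] by blast
    from bound[OF this] show ?thesis
      by (intro exp_measure.integrable_const_bound[where B = K]) auto
  qed
  show "\<bar>stopped_mean f y x\<bar> \<le> K" if "\<And>t. 0 \<le> t \<Longrightarrow> t \<le> x \<Longrightarrow> \<bar>f t\<bar> \<le> K"
  proof -
    have "\<bar>stopped_mean f y x\<bar> \<le> (\<integral>u. \<bar>f (min (u / y) x)\<bar> \<partial>exp_measure)"
      unfolding stopped_mean_def by (rule integral_abs_bound)
    also have "\<dots> \<le> (\<integral>u. K \<partial>exp_measure)"
      using bound[OF that] int by (intro integral_mono_AE) auto
    finally show ?thesis by simp
  qed
qed

lemma locally_bounded_stopped_mean:
  assumes f: "f \<in> borel_measurable borel" "locally_bounded f" and y: "y > 0"
  shows "locally_bounded (stopped_mean f y)"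
  unfolding locally_bounded_def
proof
  fix X :: real
  obtain K where K: "\<And>t. 0 \<le> t \<Longrightarrow> t \<le> X \<Longrightarrow> \<bar>f t\<bar> \<le> K"
    using locally_boundedE[OF f(2)] by blast
  have "\<bar>stopped_mean f y x\<bar> \<le> K" if "x \<in> {0..X}" for x
    using that K by (intro abs_stopped_mean_le f y) auto
  then show "bounded (stopped_mean f y ` {0..X})"
    unfolding bounded_iff by (intro exI[of _ K]) auto
qed

lemma stopped_mean_add:
  assumes "f \<in> borel_measurable borel" "locally_bounded f" "g \<in> borel_measurable borel"
    "locally_bounded g" and "y > 0" "x \<ge> 0"
  shows "stopped_mean (\<lambda>t. f t + g t) y x = stopped_mean f y x + stopped_mean g y x"
  unfolding stopped_mean_def
  using integrable_stopped[OF assms(1,2,5,6)] integrable_stopped[OF assms(3,4,5,6)] by simp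

lemma stopped_mean_mono:
  assumes "mono g" "y > 0" "0 \<le> x" "x \<le> z"
  shows "stopped_mean g y x \<le> stopped_mean g y z"
  unfolding stopped_mean_def
proof (rule Bochner_Integration.integral_mono)
  show "g (min (u / y) x) \<le> g (min (u / y) z)" for u
    using assms by (intro monoD[OF \<open>mono g\<close>]) (auto simp: min_def)
qed (use assms in \<open>intro integrable_stopped borel_measurable_mono locally_bounded_mono; simp\<close>)+

lemma stopped_mean_tendsto:
  assumes [measurable]: "f \<in> borel_measurable borel" and w: "integrable exp_measure w"
    and bound: "\<And>x u. x \<ge> 1 \<Longrightarrow> u > 0 \<Longrightarrow> \<bar>f (min (u / y) x)\<bar> \<le> w u"
  shows "(stopped_mean f y \<longlongrightarrow> abel_mean f (1 / y)) at_top"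
  unfolding stopped_mean_def[abs_def] abel_mean_def times_divide_eq_left mult_1
proof (rule integral_dominated_convergence_at_top)
  show "\<forall>\<^sub>F x in at_top. AE u in exp_measure. norm (f (min (u / y) x)) \<le> w u"
    using eventually_ge_at_top[of 1]
  proof eventually_elim
    case (elim x)
    show ?case
      using AE_exp_measure_pos by eventually_elim (use bound[OF elim] in simp)
  qed
  show "AE u in exp_measure. ((\<lambda>x. f (min (u / y) x)) \<longlongrightarrow> f (u / y)) at_top"
  proof (rule AE_I2)
    fix u
    have "\<forall>\<^sub>F x in at_top. f (min (u / y) x) = f (u / y)"
      using eventually_ge_at_top[of "u / y"] by eventually_elim (simp add: min_absorb1)
    then show "((\<lambda>x. f (min (u / y) x)) \<longlongrightarrow> f (u / y)) at_top"
      by (rule tendsto_eventually)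
  qed
qed (use w in measurable)

lemma stopped_mean_tendsto_of_mono:
  assumes "mono g" "y > 0" and int: "integrable exp_measure (\<lambda>u. g (u / y))"
  shows "(stopped_mean g y \<longlongrightarrow> abel_mean g (1 / y)) at_top"
proof (rule stopped_mean_tendsto)
  show "integrable exp_measure (\<lambda>u. \<bar>g 0\<bar> + \<bar>g (u / y)\<bar>)"
    using int by simp
  show "\<bar>g (min (u / y) x)\<bar> \<le> \<bar>g 0\<bar> + \<bar>g (u / y)\<bar>" if "x \<ge> 1" "u > 0" for x u
    using monoD[OF \<open>mono g\<close>, of 0 "min (u / y) x"] monoD[OF \<open>mono g\<close>, of "min (u / y) x" "u / y"]
      that \<open>y > 0\<close> by simp
qed (use \<open>mono g\<close> in \<open>rule borel_measurable_mono\<close>)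

lemma stopped_mean_tendsto_of_ln_asymptotics:
  assumes f: "f \<in> borel_measurable borel" "locally_bounded f"
    and lim: "((\<lambda>t. f t - b * ln t) \<longlongrightarrow> c) at_top" and y: "y > 0"
  shows "(stopped_mean f y \<longlongrightarrow> abel_mean f (1 / y)) at_top"
proof -
  obtain K where K: "\<And>x u. 1 \<le> x \<Longrightarrow> 0 < u \<Longrightarrow> \<bar>f (x * u) - b * ln x\<bar> \<le> K + \<bar>b\<bar> * \<bar>ln u\<bar>"
    using locally_bounded_ln_majorant[OF f(2) lim] by blast
  show ?thesis
  proof (rule stopped_mean_tendsto[OF f(1)])
    show "integrable exp_measure (\<lambda>u. K + \<bar>b\<bar> * \<bar>ln (u / y)\<bar>)"
      using integrable_dilate_ln[of "1 / y"] y by auto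
    show "\<bar>f (min (u / y) x)\<bar> \<le> K + \<bar>b\<bar> * \<bar>ln (u / y)\<bar>" if "x \<ge> 1" "u > 0" for x u
    proof -
      have pos: "u / y > 0" using that y by simp
      have "\<bar>ln (min (u / y) x)\<bar> \<le> \<bar>ln (u / y)\<bar>"
      proof (cases "u / y \<le> x")
        case False
        then have "0 \<le> ln x" "ln x \<le> ln (u / y)"
          using that by (auto intro!: ln_mono)
        then show ?thesis using False by simp
      qed simp
      then have "\<bar>b\<bar> * \<bar>ln (min (u / y) x)\<bar> \<le> \<bar>b\<bar> * \<bar>ln (u / y)\<bar>"
        by (rule mult_left_mono) simp
      then show ?thesis
        using K[of 1 "min (u / y) x"] pos that(1) by simp
    qed
  qed
qed

lemma integrable_of_stopped_mean_bounded:
  assumes "mono g" "0 \<le> g 0" and y: "y > 0"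
    and bound: "\<And>x. x \<ge> 0 \<Longrightarrow> stopped_mean g y x \<le> C"
  shows "integrable exp_measure (\<lambda>u. g (u / y))"
proof -
  have g: "g \<in> borel_measurable borel" "locally_bounded g"
    using \<open>mono g\<close> by (auto intro: borel_measurable_mono locally_bounded_mono)
  have "incseq (\<lambda>n. stopped_mean g y (real n))"
    using \<open>mono g\<close> y by (intro incseq_SucI stopped_mean_mono) auto
  then obtain l where l: "(\<lambda>n. stopped_mean g y (real n)) \<longlonglongrightarrow> l"
    using incseq_convergent[of _ C] bound by (metis of_nat_0_le_iff)
  show ?thesis
  proof (rule integral_monotone_convergence_nonneg(1))
    show "integrable exp_measure (\<lambda>u. g (min (u / y) (real n)))" for n
      using g y by (intro integrable_stopped) auto
    show "AE u in exp_measure. mono (\<lambda>n. g (min (u / y) (real n)))"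
      using monoD[OF \<open>mono g\<close>] by (auto intro!: monoI AE_I2)
    show "AE u in exp_measure. 0 \<le> g (min (u / y) (real n))" for n
      using AE_exp_measure_pos
    proof eventually_elim
      case (elim u)
      then show ?case
        using \<open>0 \<le> g 0\<close> monoD[OF \<open>mono g\<close>, of 0 "min (u / y) (real n)"] y by simp
    qed
    show "AE u in exp_measure. (\<lambda>n. g (min (u / y) (real n))) \<longlonglongrightarrow> g (u / y)"
    proof (rule AE_I2)
      fix u
      have "\<forall>\<^sub>F n in sequentially. u / y \<le> real n"
        by real_asymp
      then have "\<forall>\<^sub>F n in sequentially. g (min (u / y) (real n)) = g (u / y)"
        by eventually_elim (simp add: min_absorb1)
      then show "(\<lambda>n. g (min (u / y) (real n))) \<longlonglongrightarrow> g (u / y)"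
        by (rule tendsto_eventually)
    qed
    show "(\<lambda>n. \<integral>u. g (min (u / y) (real n)) \<partial>exp_measure) \<longlonglongrightarrow> l"
      using l by (simp add: stopped_mean_def)
  qed (use g in measurable)
qed

lemma stopped_mean_eq_integral:
  assumes f: "f \<in> borel_measurable borel" "locally_bounded f" and y: "y > 0" and x: "x \<ge> 0"
  shows "stopped_mean f y x = exp (- y * x) * f x + y * integral {0..x} (\<lambda>t. f t * exp (- y * t))"
proof -
  note [measurable] = f(1)
  let ?g = "\<lambda>t. indicator {..x} t * f t"
  have split: "f (min t x) = ?g t + f x * indicator {x<..} t" for t
    by (auto simp: indicator_def min_def)
  have int_tail: "integrable exp_measure (\<lambda>u. f x * indicator {x<..} (u / y))"
    by (intro exp_measure.integrable_const_bound[where B = "\<bar>f x\<bar>"]) (auto simp: indicator_def)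
  have "(\<lambda>u. indicator {x<..} (u / y)) = (indicator {y * x<..} :: real \<Rightarrow> real)"
    using y by (auto simp: indicator_def field_simps fun_eq_iff)
  then have tail: "(\<integral>u. f x * indicator {x<..} (u / y) \<partial>exp_measure) = exp (- y * x) * f x"
    using x y by (simp add: measure_exp_measure_greaterThan)
  have "integrable exp_measure (\<lambda>u. f (min (u / y) x) - f x * indicator {x<..} (u / y))"
    using integrable_stopped[OF f y x] int_tail by simp
  then have int_g: "integrable exp_measure (\<lambda>u. ?g (u / y))"
    by (simp add: split)
  then have "has_bochner_integral lborel (\<lambda>t. indicator {0..} t *\<^sub>R (?g t * exp (- y * t)))
      ((\<integral>u. ?g (u / y) \<partial>exp_measure) / y)"
    using has_bochner_integral_integrable[OF int_g]
      has_bochner_integral_exp_measure_scale[of ?g y] y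
    by simp
  also have "(\<lambda>t. indicator {0..} t *\<^sub>R (?g t * exp (- y * t)))
      = (\<lambda>t. indicator {0..x} t *\<^sub>R (f t * exp (- y * t)))"
    by (auto simp: indicator_def)
  finally have "set_integrable lborel {0..x} (\<lambda>t. f t * exp (- y * t))"
    and "(LINT t:{0..x}|lborel. f t * exp (- y * t)) = (\<integral>u. ?g (u / y) \<partial>exp_measure) / y"
    by (auto simp: has_bochner_integral_iff set_integrable_def set_lebesgue_integral_def)
  then have "(\<integral>u. ?g (u / y) \<partial>exp_measure) = y * integral {0..x} (\<lambda>t. f t * exp (- y * t))"
    using y by (simp add: set_borel_integral_eq_integral(2))
  then show ?thesis
    using int_g int_tail tail by (simp add: stopped_mean_def split)
qed

lemma partial_laplace_eq:
  assumes V: "variation_majorant_on UNIV s V" and x: "x \<ge> 0" and y: "y > 0"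
  shows "partial_laplace s y x = stopped_mean s y x - s 0"
proof -
  note s = borel_measurable_variation_majorant[OF V] locally_bounded_variation_majorant[OF V]
  let ?I = "by_parts_integral (\<lambda>t. exp (- y * t)) (\<lambda>t. - y * exp (- y * t)) s 0 x"
  have "has_RS_integral (\<lambda>t. exp (- y * t)) s 0 x ?I"
  proof (rule has_RS_integral_by_parts[OF x, where K = y])
    show "variation_majorant_on {0..x} s V"
      using V by (rule variation_majorant_on_subset) simp
    show "((\<lambda>t. exp (- y * t)) has_real_derivative - y * exp (- y * t)) (at t within {0..x})" for t
      by (auto intro!: derivative_eq_intros)
    show "\<bar>- y * exp (- y * t)\<bar> \<le> y" if "t \<in> {0..x}" for t
      using that y by (simp add: abs_mult)
    have "(\<lambda>t. (- y * exp (- y * t)) * s t) integrable_on {0..x}"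
      by (intro integrable_on_continuous_mult_locally_bounded s continuous_intros)
    then show "(\<lambda>t. s t * (- y * exp (- y * t))) integrable_on {0..x}"
      by (simp only: mult.commute)
  qed
  also have "?I = stopped_mean s y x - s 0"
    unfolding stopped_mean_eq_integral[OF s y x] by_parts_integral_def
    by (simp add: mult.left_commute[of "s _"])
  finally show ?thesis
    using x by (simp add: partial_laplace_def RS_integral_eq)
qed

corollary laplace_C_imp_cesaro_stopped_mean:
  assumes V: "variation_majorant_on UNIV s V" and y: "y > 0" and "laplace_C s y l"
  obtains k where "cesaro_lim (stopped_mean s y) k (l + s 0)"
proof -
  note s = borel_measurable_variation_majorant[OF V] locally_bounded_variation_majorant[OF V]
  obtain k where "cesaro_lim (partial_laplace s y) k l"
    using assms(3) by (auto simp: laplace_C_def)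
  then have "cesaro_lim (\<lambda>x. stopped_mean s y x - s 0) k l"
    using partial_laplace_eq[OF V _ y] by (subst (asm) cesaro_lim_cong)
  then have "cesaro_lim (\<lambda>x. stopped_mean s y x - s 0 - (- s 0)) k (l - (- s 0))"
    by (rule cesaro_lim_diff_const)
       (use s y in
         \<open>auto intro!: locally_bounded_diff locally_bounded_stopped_mean locally_bounded_const\<close>)
  then show ?thesis
    using that by simp
qed

section \<open>The logarithmic Tauberian condition\<close>

locale ln_tauberian =
  fixes f g :: "real \<Rightarrow> real" and A c :: real
  assumes f_measurable [measurable]: "f \<in> borel_measurable borel"
    and f_locally_bounded: "locally_bounded f"
    and g_mono: "mono g"
    and g_nonneg: "0 \<le> g 0"
    and diff_asymptotics: "((\<lambda>t. (g t - f t) - A * ln t) \<longlongrightarrow> c) at_top"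
begin

lemma g_measurable [measurable]: "g \<in> borel_measurable borel"
  using g_mono by (rule borel_measurable_mono)

lemma diff_locally_bounded: "locally_bounded (\<lambda>t. g t - f t)"
  using locally_bounded_mono[OF g_mono] f_locally_bounded by (rule locally_bounded_diff)

lemma diff_measurable: "(\<lambda>t. g t - f t) \<in> borel_measurable borel"
  by measurable

lemmas integrable_dilate_diff =
  integrable_dilate_of_ln_asymptotics[OF diff_measurable diff_locally_bounded diff_asymptotics]

lemmas stopped_mean_diff_tendsto =
  stopped_mean_tendsto_of_ln_asymptotics[OF diff_measurable diff_locally_bounded diff_asymptotics]

lemma stopped_mean_split:
  assumes "y > 0" "x \<ge> 0"
  shows "stopped_mean g y x = stopped_mean f y x + stopped_mean (\<lambda>t. g t - f t) y x"
  using stopped_mean_add[OF f_measurable f_locally_bounded diff_measurable diff_locally_bounded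
    assms] by simp

lemma integrable_of_cesaro_lim:
  assumes y: "y > 0" and ces: "cesaro_lim (stopped_mean f y) k l"
  shows "integrable exp_measure (\<lambda>u. g (u / y))"
proof (rule integrable_of_stopped_mean_bounded[OF g_mono g_nonneg y])
  fix x :: real assume x: "x \<ge> 0"
  define m where "m = abel_mean (\<lambda>t. g t - f t) (1 / y)"
  have "\<forall>\<^sub>F z in at_top. stopped_mean (\<lambda>t. g t - f t) y z < m + 1"
    using stopped_mean_diff_tendsto[OF y] unfolding m_def by (rule order_tendstoD(2)) simp
  then have "\<forall>\<^sub>F z in at_top. stopped_mean g y x - (m + 1) \<le> stopped_mean f y z"
    using eventually_ge_at_top[of x]
  proof eventually_elim
    case (elim z)
    then show ?case
      using stopped_mean_mono[OF g_mono y x elim(2)] stopped_mean_split[OF y, of z] x by linarith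
  qed
  then have "stopped_mean g y x - (m + 1) \<le> l"
    using f_measurable f_locally_bounded y
    by (intro cesaro_lim_lower_bound[OF _ _ ces] locally_bounded_stopped_mean) auto
  then show "stopped_mean g y x \<le> l + (m + 1)" by simp
qed

lemma cesaro_lim_eq_abel_mean:
  assumes y: "y > 0" and ces: "cesaro_lim (stopped_mean f y) k l"
  shows "l = abel_mean f (1 / y)"
proof (rule cesaro_lim_unique[OF _ _ ces])
  have int: "integrable exp_measure (\<lambda>u. g (1 / y * u))"
    "integrable exp_measure (\<lambda>u. g (1 / y * u) - f (1 / y * u))"
    using integrable_of_cesaro_lim[OF assms] integrable_dilate_diff[of "1 / y"] y by simp_all
  have "((\<lambda>x. stopped_mean g y x - stopped_mean (\<lambda>t. g t - f t) y x)
      \<longlongrightarrow> abel_mean g (1 / y) - abel_mean (\<lambda>t. g t - f t) (1 / y)) at_top"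
    using int(1) y
    by (intro tendsto_diff stopped_mean_tendsto_of_mono stopped_mean_diff_tendsto g_mono) auto
  also have "abel_mean g (1 / y) - abel_mean (\<lambda>t. g t - f t) (1 / y) = abel_mean f (1 / y)"
    unfolding abel_mean_def Bochner_Integration.integral_diff[OF int, symmetric] by simp
  finally show "(stopped_mean f y \<longlongrightarrow> abel_mean f (1 / y)) at_top"
  proof (rule Lim_transform_eventually)
    show "\<forall>\<^sub>F x in at_top. stopped_mean g y x - stopped_mean (\<lambda>t. g t - f t) y x
        = stopped_mean f y x"
      using eventually_ge_at_top[of 0] by eventually_elim (simp add: stopped_mean_split[OF y])
  qed
qed (use f_measurable f_locally_bounded y in \<open>auto intro: locally_bounded_stopped_mean\<close>)

lemma abel_mean_ln_asymptotics_iff: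
  assumes int: "\<And>x. x > 0 \<Longrightarrow> integrable exp_measure (\<lambda>u. g (x * u))"
  shows "((\<lambda>x. abel_mean f x - b * ln x) \<longlongrightarrow> a) at_top \<longleftrightarrow>
         ((\<lambda>t. f t - b * ln t) \<longlongrightarrow> a + b * euler_mascheroni) at_top"
proof
  assume "((\<lambda>t. f t - b * ln t) \<longlongrightarrow> a + b * euler_mascheroni) at_top"
  from abel_mean_ln_asymptotics[OF f_measurable f_locally_bounded this]
  show "((\<lambda>x. abel_mean f x - b * ln x) \<longlongrightarrow> a) at_top"
    by simp
next
  assume lim: "((\<lambda>x. abel_mean f x - b * ln x) \<longlongrightarrow> a) at_top"
  have "((\<lambda>x. (abel_mean f x - b * ln x) + (abel_mean (\<lambda>t. g t - f t) x - A * ln x))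
      \<longlongrightarrow> a + (c - A * euler_mascheroni)) at_top"
    by (intro tendsto_add lim abel_mean_ln_asymptotics diff_measurable diff_locally_bounded
        diff_asymptotics)
  then have "((\<lambda>x. abel_mean g x - (b + A) * ln x) \<longlongrightarrow> a + (c - A * euler_mascheroni)) at_top"
  proof (rule Lim_transform_eventually)
    show "\<forall>\<^sub>F x in at_top. (abel_mean f x - b * ln x) + (abel_mean (\<lambda>t. g t - f t) x - A * ln x)
        = abel_mean g x - (b + A) * ln x"
      using eventually_gt_at_top[of 0]
    proof eventually_elim
      case (elim x)
      have "abel_mean f x = (\<integral>u. g (x * u) - (g (x * u) - f (x * u)) \<partial>exp_measure)"
        by (simp add: abel_mean_def)
      also have "\<dots> = abel_mean g x - abel_mean (\<lambda>t. g t - f t) x"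
        unfolding abel_mean_def
        by (intro Bochner_Integration.integral_diff int integrable_dilate_diff elim)
      finally show ?case by (simp add: algebra_simps)
    qed
  qed
  from tendsto_diff[OF de_haan_tauberian[OF g_mono int this] diff_asymptotics]
  show "((\<lambda>t. f t - b * ln t) \<longlongrightarrow> a + b * euler_mascheroni) at_top"
    by (simp add: algebra_simps)
qed

theorem cesaro_lim_ln_asymptotics_iff:
  assumes ces: "\<And>y. y > 0 \<Longrightarrow> \<exists>k. cesaro_lim (stopped_mean f y) k (l y)"
  shows "((\<lambda>y. l y - b * ln (1 / y)) \<longlongrightarrow> a) (at_right 0) \<longleftrightarrow>
         ((\<lambda>t. f t - b * ln t) \<longlongrightarrow> a + b * euler_mascheroni) at_top"
proof -
  have "((\<lambda>y. l y - b * ln (1 / y)) \<longlongrightarrow> a) (at_right 0) \<longleftrightarrow>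
      ((\<lambda>x. l (inverse x) - b * ln (1 / inverse x)) \<longlongrightarrow> a) at_top"
    by (rule filterlim_at_right_to_top)
  also have "\<dots> \<longleftrightarrow> ((\<lambda>x. abel_mean f x - b * ln x) \<longlongrightarrow> a) at_top"
  proof (rule filterlim_cong[OF refl refl])
    have l_eq: "l (1 / x) = abel_mean f x" if "x > 0" for x
      using ces[of "1 / x"] cesaro_lim_eq_abel_mean[of "1 / x"] that by auto
    show "\<forall>\<^sub>F x in at_top. l (inverse x) - b * ln (1 / inverse x) = abel_mean f x - b * ln x"
      using eventually_gt_at_top[of 0] by eventually_elim (simp add: l_eq inverse_eq_divide)
  qed
  also have "\<dots> \<longleftrightarrow> ((\<lambda>t. f t - b * ln t) \<longlongrightarrow> a + b * euler_mascheroni) at_top"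
  proof (rule abel_mean_ln_asymptotics_iff)
    show "integrable exp_measure (\<lambda>u. g (x * u))" if "x > 0" for x
      using ces[of "1 / x"] integrable_of_cesaro_lim[of "1 / x"] that by (auto simp: mult.commute)
  qed
  finally show ?thesis .
qed

end

lemma ln_tauberian_of_mono_on:
  assumes "f \<in> borel_measurable borel" "locally_bounded f" and B: "B > 0"
    and mono: "mono_on {B..} (\<lambda>t. f t + A * ln t)"
  obtains g c where "ln_tauberian f g A c"
proof -
  define c where "c = - (f B + A * ln B)"
  define g where "g t = f (max t B) + A * ln (max t B) + c" for t
  have "mono g"
  proof (rule monoI)
    fix x z :: real assume "x \<le> z"
    then show "g x \<le> g z"
      using mono_onD[OF mono, of "max x B" "max z B"]
      by (simp add: g_def max.coboundedI1 max.coboundedI2)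
  qed
  moreover have "0 \<le> g 0"
    using B by (simp add: g_def c_def max_absorb2)
  moreover have "((\<lambda>t. (g t - f t) - A * ln t) \<longlongrightarrow> c) at_top"
  proof (rule tendsto_eventually)
    show "\<forall>\<^sub>F t in at_top. (g t - f t) - A * ln t = c"
      using eventually_ge_at_top[of B] by eventually_elim (simp add: g_def max_absorb1)
  qed
  ultimately have "ln_tauberian f g A c"
    using assms by unfold_locales
  then show ?thesis by (rule that)
qed

theorem theorem3p7:
  fixes s :: "real \<Rightarrow> real" and L :: "real \<Rightarrow> real" and a b :: real
  assumes bv: "locally_bounded_variation s"
    and neg: "\<And>x. x < 0 \<Longrightarrow> s x = 0"
    and lap: "\<And>y. y > 0 \<Longrightarrow> laplace_C s y (L y)"
    and tauber: "\<exists>A>0. \<exists>B>0. mono_on {B..} (\<lambda>x. s x + A * ln x)"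
  shows "((\<lambda>y. L y - (a + b * ln (1 / y))) \<longlongrightarrow> 0) (at_right 0) \<longleftrightarrow>
         ((\<lambda>x. s x - (s 0 + a + b * euler_mascheroni + b * ln x)) \<longlongrightarrow> 0) at_top"
proof -
  obtain V where V: "variation_majorant_on UNIV s V"
    using variation_majorant_exists[OF bv neg] by blast
  obtain A B where "B > 0" "mono_on {B..} (\<lambda>x. s x + A * ln x)"
    using tauber by blast
  then obtain g c where "ln_tauberian s g A c"
    using ln_tauberian_of_mono_on borel_measurable_variation_majorant[OF V]
      locally_bounded_variation_majorant[OF V] by blast
  then interpret ln_tauberian s g A c .
  have "((\<lambda>y. L y - (a + b * ln (1 / y))) \<longlongrightarrow> 0) (at_right 0) \<longleftrightarrow>
      ((\<lambda>y. (L y + s 0) - b * ln (1 / y)) \<longlongrightarrow> s 0 + a) (at_right 0)"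
    by (subst (2) LIM_zero_iff[symmetric]) (simp add: algebra_simps)
  also have "\<dots> \<longleftrightarrow> ((\<lambda>x. s x - b * ln x) \<longlongrightarrow> s 0 + a + b * euler_mascheroni) at_top"
    using laplace_C_imp_cesaro_stopped_mean[OF V _ lap]
    by (intro cesaro_lim_ln_asymptotics_iff) blast
  also have "\<dots> \<longleftrightarrow> ((\<lambda>x. s x - (s 0 + a + b * euler_mascheroni + b * ln x)) \<longlongrightarrow> 0) at_top"
    by (subst LIM_zero_iff[symmetric]) (simp add: algebra_simps)
  finally show ?thesis .
qed

end
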